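(* Let $E\subset\mathbb{R}^d$ be a nonempty set and let $\mathcal{D}$ be a dyadic lattice in $\mathbb{R}^d$. The following properties are equivalent. (i) $E$ is porous. (ii) The family $\mathcal{D}_E$ is well-sparse with respect to $E$. (iii) There exist constants $\alpha>0$ and $\zeta>0$ such that for each cube $R\in\mathcal{D}$ $$\sum_{Q\in\mathcal{D}_E(R)}|Q|^{1-\alpha/d}\leq \zeta\,|R|^{1-\alpha/d}.$$ (iv) $|\overline{E}|=0$ and there exist constants $\alpha>0$ and $\xi>0$ such that for each cube $R\in\mathcal{D}$ $$\sum_{Q\in\mathcal{D}_E(R)}\mu_{\alpha,E}(Q)\leq \xi\,\mu_{\alpha,E}(R).$$
   Context: $|A|$ denotes $d$-dimensional Lebesgue measure of $A$, and $\overline{E}$ is the closure of $E$. Distances are taken in the $l_\infty$-metric: $\mathrm{dist}(F,E)=\inf_{x\in F,\,y\in E}\max_{1\le i\le d}|x_i-y_i|$, and $\mathrm{dist}(x,E)=\mathrm{dist}(\{x\},E)$. A cube is a half-open set $Q=[a_1,b_1)\times\dots\times[a_d,b_d)$ with equal side lengths $\ell(Q)=b_1-a_1=\dots=b_d-a_d>0$. For a cube $R$, $\mathcal{D}(R)=\bigcup_{j\ge0}\mathcal{D}_j(R)$, where $\mathcal{D}_j(R)$ is the collection of the $2^{jd}$ pairwise disjoint half-open cubes of side length $2^{-j}\ell(R)$ whose union is $R$. A dyadic lattice $\mathcal{D}$ is a collection of cubes such that: (DL1) if $Q\in\mathcal{D}$ then $\mathcal{D}(Q)\subset\mathcal{D}$;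 (DL2) any two cubes $Q',Q''\in\mathcal{D}$ have a common ancestor, i.e. there is $Q\in\mathcal{D}$ with $Q',Q''\in\mathcal{D}(Q)$; (DL3) for every compact $K\subset\mathbb{R}^d$ there is a cube $Q\in\mathcal{D}$ containing $K$. For $R\in\mathcal{D}$, $\mathcal{D}_E(R)=\{Q\in\mathcal{D}(R): Q\cap E\ne\varnothing\}$, and $\mathcal{D}_E=\bigcup_{R\in\mathcal{D}}\mathcal{D}_E(R)$. A cube $Q'\in\mathcal{D}$ is called free if $Q'\cap E=\varnothing$. A nonempty set $E$ is porous (with respect to $\mathcal{D}$) if there is a constant $\eta>1$ such that for each $R\in\mathcal{D}$ there is a free cube $M(R)\in\mathcal{D}$, $M(R)\subset R$, with $\eta|M(R)|\ge|R|$. A collection $\mathcal{S}\subset\mathcal{D}$ is well-sparse with respect to $E$ if there exist a constant $\lambda>1$ and a family of cubes $M(Q)\subset Q$, $Q\in\mathcal{S}$, such that $M(Q')\cap M(Q'')=\varnothing$ for $Q'\ne Q''$, $\lambda|M(Q)|\ge|Q|$ and $M(Q)\cap E=\varnothing$ for each $Q\in\mathcal{S}$. $\mu_{\alpha,E}(R)=\int_R \mathrm{dist}(x,E)^{-\alpha}\,dx$.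
   Formalization: In (iv), the constant α is additionally required to make μ_{α,E}(R) finite for every cube R in D; without this, (iv) holds trivially with α ≥ d for any E with null closure, e.g. the non-porous set {0} ∪ {1/n} in R. *)

theory Defs
  imports "HOL-Analysis.Analysis"
begin

section \<open>Cubes and dyadic lattices\<close>

definition hcube :: "real ^ 'n \<Rightarrow> real \<Rightarrow> (real ^ 'n) set" where
  "hcube a l = {x. \<forall>i. a $ i \<le> x $ i \<and> x $ i < a $ i + l}"

definition is_cube :: "(real ^ 'n) set \<Rightarrow> bool" where
  "is_cube Q \<longleftrightarrow> (\<exists>a l. 0 < l \<and> Q = hcube a l)"

text \<open>The grid of the half-open cubes of side \<open>l / 2 ^ j\<close> that subdivide \<open>R = hcube a l\<close>.
  The lemma \<open>dyadic_gen_iff\<close> below shows that this is the only collection of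
  \<open>2 ^ (j * d)\<close> pairwise disjoint half-open cubes of this side with union \<open>R\<close>.\<close>

definition dyadic_gen :: "nat \<Rightarrow> (real ^ 'n) set \<Rightarrow> (real ^ 'n) set set" where
  "dyadic_gen j R =
     {hcube (\<chi> i. a $ i + real (k i) * (l / 2 ^ j)) (l / 2 ^ j) | a l (k :: 'n \<Rightarrow> nat).
        0 < l \<and> R = hcube a l \<and> (\<forall>i. k i < 2 ^ j)}"

definition dyadic :: "(real ^ 'n) set \<Rightarrow> (real ^ 'n) set set" where
  "dyadic R = (\<Union>j. dyadic_gen j R)"

definition dyadic_lattice :: "(real ^ 'n) set set \<Rightarrow> bool" where
  "dyadic_lattice D \<longleftrightarrow>
     (\<forall>Q\<in>D. is_cube Q) \<and>
     (\<forall>Q\<in>D. dyadic Q \<subseteq> D) \<and>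
     (\<forall>Q'\<in>D. \<forall>Q''\<in>D. \<exists>Q\<in>D. Q' \<in> dyadic Q \<and> Q'' \<in> dyadic Q) \<and>
     (\<forall>K. compact K \<longrightarrow> (\<exists>Q\<in>D. K \<subseteq> Q))"

definition dyadic_meeting :: "(real ^ 'n) set \<Rightarrow> (real ^ 'n) set \<Rightarrow> (real ^ 'n) set set" where
  "dyadic_meeting E R = {Q \<in> dyadic R. Q \<inter> E \<noteq> {}}"

definition lattice_meeting :: "(real ^ 'n) set set \<Rightarrow> (real ^ 'n) set \<Rightarrow> (real ^ 'n) set set" where
  "lattice_meeting D E = (\<Union>R\<in>D. dyadic_meeting E R)"


section \<open>Porous sets and well-sparse families\<close>

definition free_cube :: "(real ^ 'n) set set \<Rightarrow> (real ^ 'n) set \<Rightarrow> (real ^ 'n) set \<Rightarrow> bool" where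
  "free_cube D E Q \<longleftrightarrow> Q \<in> D \<and> Q \<inter> E = {}"

definition porous :: "(real ^ 'n) set set \<Rightarrow> (real ^ 'n) set \<Rightarrow> bool" where
  "porous D E \<longleftrightarrow> E \<noteq> {} \<and>
     (\<exists>\<eta>>1. \<forall>R\<in>D. \<exists>M. free_cube D E M \<and> M \<subseteq> R \<and>
        measure lebesgue R \<le> \<eta> * measure lebesgue M)"

text \<open>The cubes \<open>M Q\<close> need not belong to the lattice.\<close>

definition well_sparse ::
  "(real ^ 'n) set set \<Rightarrow> (real ^ 'n) set set \<Rightarrow> (real ^ 'n) set \<Rightarrow> bool" where
  "well_sparse D S E \<longleftrightarrow> S \<subseteq> D \<and>
     (\<exists>c>1. \<exists>M.
        (\<forall>Q\<in>S. is_cube (M Q) \<and> M Q \<subseteq> Q) \<and>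
        (\<forall>Q'\<in>S. \<forall>Q''\<in>S. Q' \<noteq> Q'' \<longrightarrow> M Q' \<inter> M Q'' = {}) \<and>
        (\<forall>Q\<in>S. measure lebesgue Q \<le> c * measure lebesgue (M Q) \<and> M Q \<inter> E = {}))"


section \<open>Distance weights\<close>

definition linf_dist :: "(real ^ 'n) set \<Rightarrow> (real ^ 'n) set \<Rightarrow> real" where
  "linf_dist F E = (INF (x, y) \<in> F \<times> E. infnorm (x - y))"

text \<open>For \<open>\<alpha> > 0\<close> the integrand is \<open>\<infinity>\<close> where the distance is \<open>0\<close>, as \<open>inverse 0 = \<infinity>\<close>
  in \<^typ>\<open>ennreal\<close>. The integral itself may be \<open>\<infinity>\<close>; a condition that compares weights of
  cubes has to require them to be finite. If \<open>\<alpha>\<close> is at least the dimension, every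
  half-open cube that meets \<open>E\<close> has infinite weight, so such a comparison would hold vacuously.\<close>

definition dist_weight :: "real \<Rightarrow> (real ^ 'n) set \<Rightarrow> (real ^ 'n) set \<Rightarrow> ennreal" where
  "dist_weight \<alpha> E R = (\<integral>\<^sup>+ x \<in> R. inverse (ennreal (linf_dist {x} E powr \<alpha>)) \<partial>lebesgue)"


section \<open>Characterization of the dyadic generations\<close>

lemma hcube_corner_mem: "0 < l \<Longrightarrow> a \<in> hcube a l"
  by (auto simp: hcube_def)

lemma hcube_subsetD:
  fixes a b :: "real ^ 'n"
  assumes "0 < l" "hcube a l \<subseteq> hcube b m"
  shows "b $ i \<le> a $ i" "a $ i + l \<le> b $ i + m"
proof -
  have "a \<in> hcube b m" using assms hcube_corner_mem by blast
  then have a: "\<And>i. b $ i \<le> a $ i" "\<And>i. a $ i < b $ i + m" by (auto simp: hcube_def)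
  show "b $ i \<le> a $ i" by (rule a)
  show "a $ i + l \<le> b $ i + m"
  proof (rule ccontr)
    assume neg: "\<not> a $ i + l \<le> b $ i + m"
    let ?x = "\<chi> k. if k = i then b $ i + m else a $ k"
    have "?x \<in> hcube a l" using neg a(2)[of i] assms(1) by (auto simp: hcube_def)
    with assms(2) have "?x \<in> hcube b m" by blast
    then have "?x $ i < b $ i + m" unfolding hcube_def by blast
    then show False by simp
  qed
qed

lemma hcube_eq_iff:
  fixes a b :: "real ^ 'n"
  assumes "0 < l" "0 < m"
  shows "hcube a l = hcube b m \<longleftrightarrow> a = b \<and> l = m"
proof
  assume eq: "hcube a l = hcube b m"
  have ab: "a = b"
    unfolding vec_eq_iff
    using hcube_subsetD(1)[OF assms(1), of a b m] hcube_subsetD(1)[OF assms(2), of b a l] eq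
    by (auto intro: antisym)
  moreover have "l = m"
    using hcube_subsetD(2)[OF assms(1), of a b m undefined]
      hcube_subsetD(2)[OF assms(2), of b a l undefined] eq ab by simp
  ultimately show "a = b \<and> l = m" ..
qed simp

lemma dyadic_gen_hcube:
  fixes a :: "real ^ 'n"
  assumes "0 < l"
  shows "dyadic_gen j (hcube a l) =
    (\<lambda>k. hcube (\<chi> i. a $ i + real (k i) * (l / 2 ^ j)) (l / 2 ^ j)) ` {k. \<forall>i. k i < 2 ^ j}"
  using assms by (auto simp: dyadic_gen_def hcube_eq_iff)

lemma interval_tiling_step:
  fixes s :: real
  assumes s: "0 < s"
    and cover: "\<And>t. A \<le> t \<Longrightarrow> t < B \<Longrightarrow> \<exists>c\<in>C. c \<le> t \<and> t < c + s"
    and disj: "\<And>c c' t. c \<in> C \<Longrightarrow> c' \<in> C \<Longrightarrow> c \<le> t \<Longrightarrow> t < c + s \<Longrightarrow> c' \<le> t \<Longrightarrow> t < c' + s \<Longrightarrow> c = c'"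
    and inside: "\<And>c. c \<in> C \<Longrightarrow> A \<le> c \<and> c + s \<le> B"
    and c: "c \<in> C" "c \<noteq> A"
  shows "c - s \<in> C"
proof -
  have "A < c" "c < B" using inside[of c] c s by auto
  obtain c1 where c1: "c1 \<in> C" "c1 \<le> max A (c - s)" "max A (c - s) < c1 + s"
  proof -
    have "A \<le> max A (c - s)" "max A (c - s) < B" using \<open>A < c\<close> \<open>c < B\<close> s by auto
    from cover[OF this] that show thesis by blast
  qed
  have "c1 < c" using c1(2) \<open>A < c\<close> s by (auto simp: max_def split: if_splits)
  have le: "c1 + s \<le> c"
    using disj[OF c1(1) c(1), of c] \<open>c1 < c\<close> s by (cases "c1 + s \<le> c") auto
  have "A \<le> c1" using inside[OF c1(1)] by simp
  have "c1 + s = c"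
  proof (rule ccontr)
    assume "c1 + s \<noteq> c"
    with le have lt: "c1 + s < c" by simp
    obtain c2 where c2: "c2 \<in> C" "c2 \<le> c1 + s" "c1 + s < c2 + s"
      using cover[of "c1 + s"] \<open>A \<le> c1\<close> s lt \<open>c < B\<close> by auto
    have "c1 + s \<le> c2" using c2(3) disj[OF c1(1) c2(1), of c2] s by (cases "c1 + s \<le> c2") auto
    then have "c < c2 + s" using c1(3) by simp
    then show False using disj[OF c2(1) c(1), of c] c2(2) lt s by auto
  qed
  then have "c - s = c1" by simp
  then show ?thesis using c1(1) by simp
qed

lemma interval_tiling_grid:
  fixes s :: real
  assumes s: "0 < s"
    and cover: "\<And>t. A \<le> t \<Longrightarrow> t < B \<Longrightarrow> \<exists>c\<in>C. c \<le> t \<and> t < c + s"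
    and disj: "\<And>c c' t. c \<in> C \<Longrightarrow> c' \<in> C \<Longrightarrow> c \<le> t \<Longrightarrow> t < c + s \<Longrightarrow> c' \<le> t \<Longrightarrow> t < c' + s \<Longrightarrow> c = c'"
    and inside: "\<And>c. c \<in> C \<Longrightarrow> A \<le> c \<and> c + s \<le> B"
    and c: "c \<in> C"
  shows "\<exists>k::nat. c = A + real k * s"
proof -
  have "\<forall>c\<in>C. c < A + real n * s \<longrightarrow> (\<exists>k::nat. c = A + real k * s)" for n
  proof (induction n)
    case 0
    then show ?case using inside by force
  next
    case (Suc n)
    show ?case
    proof (intro ballI impI)
      fix c assume c: "c \<in> C" "c < A + real (Suc n) * s"
      show "\<exists>k::nat. c = A + real k * s"
      proof (cases "c = A")
        case True
        then show ?thesis by (intro exI[of _ 0]) simp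
      next
        case False
        have "c - s \<in> C"
          using interval_tiling_step[of s A B C c] s cover disj inside c(1) False by blast
        moreover have "c - s < A + real n * s" using c(2) by (simp add: algebra_simps)
        ultimately obtain k :: nat where "c - s = A + real k * s" using Suc by blast
        then show ?thesis by (intro exI[of _ "Suc k"]) (simp add: algebra_simps)
      qed
    qed
  qed
  moreover obtain n :: nat where "(c - A) / s < real n" using reals_Archimedean2 by blast
  moreover from this have "c < A + real n * s" using s by (simp add: pos_divide_less_eq)
  ultimately show ?thesis using c by blast
qed

lemma dyadic_gen_unique:
  fixes a :: "real ^ 'n"
  assumes l: "0 < l"
    and P: "\<forall>Q\<in>P. \<exists>c. Q = hcube c (l / 2 ^ j)"
    and dis: "disjoint P"
    and un: "\<Union>P = hcube a l"
  shows "P \<subseteq> dyadic_gen j (hcube a l)"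
proof
  fix Q assume Q: "Q \<in> P"
  define s where "s = l / 2 ^ j"
  have s: "0 < s" and ls: "l = 2 ^ j * s" using l by (auto simp: s_def)
  obtain c where c: "Q = hcube c s" using P Q by (auto simp: s_def)
  have sub: "hcube c' s \<subseteq> hcube a l" if "hcube c' s \<in> P" for c' using un that by blast
  have cR: "c \<in> hcube a l" using sub[of c] Q c hcube_corner_mem[OF s, of c] by auto
  have "\<exists>k::nat. k < 2 ^ j \<and> c $ i = a $ i + real k * s" for i
  proof -
    define L where "L = (\<lambda>t. \<chi> m. if m = i then t else c $ m)"
    define C where "C = {c' $ i | c'. hcube c' s \<in> P \<and> (\<forall>m. m \<noteq> i \<longrightarrow> c' $ m \<le> c $ m \<and> c $ m < c' $ m + s)}"
    have L: "L t \<in> hcube c' s \<longleftrightarrow> c' $ i \<le> t \<and> t < c' $ i + s"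
      if "\<forall>m. m \<noteq> i \<longrightarrow> c' $ m \<le> c $ m \<and> c $ m < c' $ m + s" for c' t
      using that by (auto simp: L_def hcube_def)
    have inside: "a $ i \<le> x \<and> x + s \<le> a $ i + l" if "x \<in> C" for x
      using that hcube_subsetD[OF s sub] by (auto simp: C_def)
    have cover: "\<exists>x\<in>C. x \<le> t \<and> t < x + s" if t: "a $ i \<le> t" "t < a $ i + l" for t
    proof -
      have "L t \<in> hcube a l" using cR t by (auto simp: L_def hcube_def)
      then obtain Q' where Q': "Q' \<in> P" "L t \<in> Q'" using un by blast
      then obtain c' where c': "Q' = hcube c' s" using P by (auto simp: s_def)
      have mem: "\<forall>m. c' $ m \<le> L t $ m \<and> L t $ m < c' $ m + s"
        using Q' c' by (simp add: hcube_def)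
      then have o: "\<forall>m. m \<noteq> i \<longrightarrow> c' $ m \<le> c $ m \<and> c $ m < c' $ m + s"
        by (auto simp: L_def split: if_splits)
      have "c' $ i \<in> C" using o Q' c' by (auto simp: C_def)
      moreover have "c' $ i \<le> t \<and> t < c' $ i + s" using L[OF o] Q' c' by blast
      ultimately show ?thesis by blast
    qed
    have disj: "x = y"
      if xy: "x \<in> C" "y \<in> C" "x \<le> t" "t < x + s" "y \<le> t" "t < y + s" for x y t
    proof -
      obtain x' where x': "x = x' $ i" "hcube x' s \<in> P"
        "\<forall>m. m \<noteq> i \<longrightarrow> x' $ m \<le> c $ m \<and> c $ m < x' $ m + s"
        using xy(1) unfolding C_def by blast
      obtain y' where y': "y = y' $ i" "hcube y' s \<in> P"
        "\<forall>m. m \<noteq> i \<longrightarrow> y' $ m \<le> c $ m \<and> c $ m < y' $ m + s"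
        using xy(2) unfolding C_def by blast
      have "L t \<in> hcube x' s \<inter> hcube y' s" using L[OF x'(3)] L[OF y'(3)] x' y' xy by blast
      then have "hcube x' s = hcube y' s" using dis x'(2) y'(2) unfolding disjoint_def by blast
      then have "x' = y'" using hcube_eq_iff[OF s s] by blast
      then show ?thesis using x'(1) y'(1) by simp
    qed
    have cC: "c $ i \<in> C" using Q c s by (auto simp: C_def)
    obtain k :: nat where k: "c $ i = a $ i + real k * s"
      using interval_tiling_grid[of s "a $ i" "a $ i + l" C "c $ i"] s cover disj inside cC by blast
    have "real k * s + s \<le> 2 ^ j * s" using inside[OF cC] k ls by simp
    then have "(real k + 1) * s \<le> 2 ^ j * s" by (simp add: algebra_simps)
    then have "real k + 1 \<le> 2 ^ j" using s by (rule mult_right_le_imp_le)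
    then have "real k < real (2 ^ j)" unfolding of_nat_power of_nat_numeral by linarith
    then have "k < 2 ^ j" unfolding of_nat_less_iff .
    then show ?thesis using k by blast
  qed
  then obtain k where k: "\<And>i. k i < 2 ^ j \<and> c $ i = a $ i + real (k i) * s" by metis
  have "c = (\<chi> i. a $ i + real (k i) * s)" using k by (simp add: vec_eq_iff)
  then show "Q \<in> dyadic_gen j (hcube a l)"
    unfolding dyadic_gen_hcube[OF l] using k c by (auto simp: s_def)
qed

lemma dyadic_gen_tiling:
  fixes a :: "real ^ 'n"
  assumes l: "0 < l"
  shows "card (dyadic_gen j (hcube a l)) = 2 ^ (j * CARD('n))"
    and "disjoint (dyadic_gen j (hcube a l))"
    and "\<Union>(dyadic_gen j (hcube a l)) = hcube a l"
proof -
  define s where "s = l / 2 ^ j"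
  have s: "0 < s" and ls: "l = 2 ^ j * s" using l by (auto simp: s_def)
  define K where "K = {k :: 'n \<Rightarrow> nat. \<forall>i. k i < 2 ^ j}"
  define G where "G = (\<lambda>k :: 'n \<Rightarrow> nat. hcube (\<chi> i. a $ i + real (k i) * s) s)"
  have gen: "dyadic_gen j (hcube a l) = G ` K"
    unfolding dyadic_gen_hcube[OF l] by (simp add: G_def K_def s_def)
  have G: "x \<in> G k \<longleftrightarrow> (\<forall>i. k i = \<lfloor>(x $ i - a $ i) / s\<rfloor>)" for x k
  proof -
    have "a $ i + real (k i) * s \<le> x $ i \<and> x $ i < a $ i + real (k i) * s + s \<longleftrightarrow>
      int (k i) = \<lfloor>(x $ i - a $ i) / s\<rfloor>" for i
    proof -
      have "int (k i) = \<lfloor>(x $ i - a $ i) / s\<rfloor> \<longleftrightarrow>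
        real (k i) \<le> (x $ i - a $ i) / s \<and> (x $ i - a $ i) / s < real (k i) + 1"
        by (metis floor_eq_iff of_int_of_nat_eq)
      then show ?thesis using s by (auto simp: field_simps)
    qed
    then show ?thesis by (simp add: G_def hcube_def)
  qed
  have same: "k = k'" if "x \<in> G k" "x \<in> G k'" for x k k'
    using that unfolding G by (metis ext of_nat_eq_iff)
  have corner: "(\<chi> i. a $ i + real (k i) * s) \<in> G k" for k
    unfolding G_def by (rule hcube_corner_mem[OF s])
  have inj: "inj_on G K" by (rule inj_onI) (metis corner same)
  have "K = (\<Pi>\<^sub>E i\<in>UNIV. {..<2 ^ j})" by (auto simp: K_def PiE_def Pi_def)
  then have "card K = 2 ^ (j * CARD('n))" by (simp add: card_PiE power_mult)
  then show "card (dyadic_gen j (hcube a l)) = 2 ^ (j * CARD('n))"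
    using inj by (simp add: gen card_image)
  show "disjoint (dyadic_gen j (hcube a l))"
    unfolding gen disjoint_def using same by blast
  have bound: "a $ i \<le> t \<and> t < a $ i + l \<longleftrightarrow> 0 \<le> \<lfloor>(t - a $ i) / s\<rfloor> \<and> \<lfloor>(t - a $ i) / s\<rfloor> < 2 ^ j" for t i
  proof -
    have "\<lfloor>(t - a $ i) / s\<rfloor> < 2 ^ j \<longleftrightarrow> (t - a $ i) / s < 2 ^ j"
      using floor_less_iff[of "(t - a $ i) / s" "2 ^ j"] by simp
    then show ?thesis using s by (auto simp: ls field_simps)
  qed
  show "\<Union>(dyadic_gen j (hcube a l)) = hcube a l"
  proof (intro set_eqI iffI)
    fix x assume "x \<in> \<Union>(dyadic_gen j (hcube a l))"
    then obtain k where k: "k \<in> K" "\<forall>i. int (k i) = \<lfloor>(x $ i - a $ i) / s\<rfloor>"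
      unfolding gen using G by blast
    have "0 \<le> \<lfloor>(x $ i - a $ i) / s\<rfloor> \<and> \<lfloor>(x $ i - a $ i) / s\<rfloor> < 2 ^ j" for i
    proof -
      have "int (k i) < int (2 ^ j)" using k(1) unfolding K_def of_nat_less_iff by blast
      then show ?thesis using k(2) by (metis of_nat_0_le_iff of_nat_numeral of_nat_power)
    qed
    then show "x \<in> hcube a l" using bound by (simp add: hcube_def)
  next
    fix x assume "x \<in> hcube a l"
    then have b: "0 \<le> \<lfloor>(x $ i - a $ i) / s\<rfloor> \<and> \<lfloor>(x $ i - a $ i) / s\<rfloor> < 2 ^ j" for i
      using bound[of i "x $ i"] by (simp add: hcube_def)
    define k where "k = (\<lambda>i. nat \<lfloor>(x $ i - a $ i) / s\<rfloor>)"
    have "k i < 2 ^ j" for i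
      using b[of i] by (simp add: k_def nat_less_iff)
    then have "k \<in> K" by (simp add: K_def)
    moreover have "x \<in> G k" unfolding G using b by (simp add: k_def)
    ultimately show "x \<in> \<Union>(dyadic_gen j (hcube a l))" unfolding gen by blast
  qed
qed

lemma dyadic_gen_iff:
  fixes a :: "real ^ 'n"
  assumes l: "0 < l"
  shows "P = dyadic_gen j (hcube a l) \<longleftrightarrow>
    (\<forall>Q\<in>P. \<exists>c. Q = hcube c (l / 2 ^ j)) \<and> disjoint P \<and> \<Union>P = hcube a l \<and>
    card P = 2 ^ (j * CARD('n))"
proof
  assume P: "P = dyadic_gen j (hcube a l)"
  have "\<forall>Q\<in>P. \<exists>c. Q = hcube c (l / 2 ^ j)" unfolding P dyadic_gen_hcube[OF l] by blast
  then show "(\<forall>Q\<in>P. \<exists>c. Q = hcube c (l / 2 ^ j)) \<and> disjoint P \<and> \<Union>P = hcube a l \<and>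
    card P = 2 ^ (j * CARD('n))"
    using dyadic_gen_tiling[OF l, of j a] unfolding P by blast
next
  assume r: "(\<forall>Q\<in>P. \<exists>c. Q = hcube c (l / 2 ^ j)) \<and> disjoint P \<and> \<Union>P = hcube a l \<and>
    card P = 2 ^ (j * CARD('n))"
  have "finite (dyadic_gen j (hcube a l))"
    using dyadic_gen_tiling(1)[OF l, of j a] by (simp add: card_ge_0_finite)
  then show "P = dyadic_gen j (hcube a l)"
    using dyadic_gen_unique[OF l, of P j a] r dyadic_gen_tiling(1)[OF l, of j a]
    by (metis card_subset_eq)
qed

end

theory Submission
  imports Defs
begin

text \<open>Porosity passes from the lattice to all half-open cubes: every cube \<open>T\<close> contains a lattice cube
  of comparable size, so for one fixed \<open>N\<close> some cube of generation \<open>N\<close> of \<open>T\<close> misses \<open>E\<close>. Iterating,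
  at most \<open>C \<gamma> ^ j 2 ^ (j d)\<close> cubes of generation \<open>j\<close> of \<open>T\<close> meet \<open>E\<close>, with \<open>\<gamma> < 1\<close>. If
  \<open>2 powr \<alpha> * \<gamma> < 1\<close>, the resulting geometric series bounds the sums in (iii), and also the weight of
  every cube by a multiple of \<open>l powr (d - \<alpha>)\<close>, which for cubes meeting \<open>E\<close> is also a lower bound; this
  gives (iv), and finiteness of the weights forces \<open>closure E\<close> to be null. Conversely, (iii) bounds the number of
  cubes of generation \<open>j\<close> meeting \<open>E\<close> by \<open>o(2 ^ (j d))\<close>; and if no cube of generation \<open>\<le> N\<close> of
  \<open>R\<close> is free, additivity turns (iv) into \<open>N + 1 \<le> \<xi>\<close>.

  For (ii), assign to \<open>Q\<close> a free descendant \<open>P Q\<close> of least generation. Any two of these are equal or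
  disjoint, and a fixed cube is used at most once per generation \<open>g \<le> N\<close>, so subdividing it
  into enough pieces and giving the piece with index \<open>g\<close> to \<open>Q\<close> makes the choice disjoint.\<close>

subsection \<open>Dyadic descendants\<close>

lemma hcube_borel: "hcube (a :: real ^ 'n) l \<in> sets borel"
proof -
  have "hcube a l = (\<Inter>i. {x. a $ i \<le> x $ i} \<inter> {x. x $ i < a $ i + l})"
    by (auto simp: hcube_def)
  also have "\<dots> \<in> sets borel"
    by (intro sets.finite_INT sets.Int borel_closed borel_open
        closed_halfspace_component_ge_cart open_halfspace_component_lt_cart) auto
  finally show ?thesis .
qed

lemma hcube_lebesgue [measurable]: "hcube (a :: real ^ 'n) l \<in> sets lebesgue"
  using hcube_borel[of a l] by simp

text \<open>The half-open cube lies between the open and the closed box with the same corners, which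
  have equal measure.\<close>

lemma emeasure_hcube:
  fixes a :: "real ^ 'n"
  assumes "0 < l"
  shows "emeasure lebesgue (hcube a l) = ennreal (l ^ CARD('n))"
proof -
  let ?b = "\<chi> i. a $ i + l"
  have ne: "cbox a ?b \<noteq> {}" using assms by (auto simp: interval_ne_empty_cart(1) less_imp_le)
  have "measure lborel (cbox a ?b) = l ^ CARD('n)"
    using content_cbox_cart[OF ne] by simp
  then have c: "emeasure lborel (cbox a ?b) = ennreal (l ^ CARD('n))"
    using emeasure_lborel_cbox_finite[of a ?b] by (simp add: emeasure_eq_ennreal_measure)
  have b: "emeasure lborel (box a ?b) = emeasure lborel (cbox a ?b)"
    by (simp only: emeasure_lborel_box_eq emeasure_lborel_cbox_eq)
  have "emeasure lborel (box a ?b) \<le> emeasure lborel (hcube a l)"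
    using hcube_borel[of a l] by (intro emeasure_mono) (auto simp: hcube_def mem_box_cart less_imp_le)
  moreover have "emeasure lborel (hcube a l) \<le> emeasure lborel (cbox a ?b)"
    by (intro emeasure_mono) (auto simp: hcube_def mem_box_cart less_imp_le)
  ultimately have "emeasure lborel (hcube a l) = ennreal (l ^ CARD('n))" using b c by simp
  then show ?thesis using hcube_borel[of a l] by simp
qed

lemma measure_hcube:
  fixes a :: "real ^ 'n"
  assumes "0 < l"
  shows "measure lebesgue (hcube a l) = l ^ CARD('n)"
  using emeasure_hcube[OF assms, of a] assms by (simp add: measure_def)

lemma finite_dyadic_gen:
  fixes a :: "real ^ 'n"
  assumes "0 < l"
  shows "finite (dyadic_gen j (hcube a l))"
  using dyadic_gen_tiling(1)[OF assms, of j a] by (simp add: card_ge_0_finite)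

lemma dyadic_gen_shape:
  fixes a :: "real ^ 'n"
  assumes "0 < l" "Q \<in> dyadic_gen j (hcube a l)"
  shows "\<exists>b. Q = hcube b (l / 2 ^ j)"
  using assms by (auto simp: dyadic_gen_hcube)

lemma dyadic_gen_subset:
  fixes a :: "real ^ 'n"
  assumes "0 < l" "Q \<in> dyadic_gen j (hcube a l)"
  shows "Q \<subseteq> hcube a l"
  using dyadic_gen_tiling(3)[OF assms(1), of j a] assms(2) by blast

lemma dyadic_gen_cover:
  fixes a :: "real ^ 'n"
  assumes "0 < l" "x \<in> hcube a l"
  obtains b where "hcube b (l / 2 ^ j) \<in> dyadic_gen j (hcube a l)" "x \<in> hcube b (l / 2 ^ j)"
  using dyadic_gen_tiling(3)[OF assms(1), of j a] assms dyadic_gen_shape[OF assms(1)] by blast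

lemma dyadic_gen_eqI:
  fixes a :: "real ^ 'n"
  assumes "0 < l" "Q \<in> dyadic_gen j (hcube a l)" "Q' \<in> dyadic_gen j (hcube a l)" "x \<in> Q" "x \<in> Q'"
  shows "Q = Q'"
  using dyadic_gen_tiling(2)[OF assms(1), of j a] assms unfolding disjoint_def by blast

lemma dyadic_gen_trans:
  fixes a :: "real ^ 'n"
  assumes l: "0 < l" and Q: "Q \<in> dyadic_gen i (hcube a l)" and P: "P \<in> dyadic_gen j Q"
  shows "P \<in> dyadic_gen (i + j) (hcube a l)"
proof -
  obtain k where k: "\<forall>m. k m < 2 ^ i" "Q = hcube (\<chi> m. a $ m + real (k m) * (l / 2 ^ i)) (l / 2 ^ i)"
    using Q unfolding dyadic_gen_hcube[OF l] by blast
  have l': "0 < l / 2 ^ i" using l by simp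
  obtain k' where k': "\<forall>m. k' m < 2 ^ j"
    "P = hcube (\<chi> m. a $ m + real (k m) * (l / 2 ^ i) + real (k' m) * (l / 2 ^ i / 2 ^ j)) (l / 2 ^ i / 2 ^ j)"
    using P unfolding k(2) dyadic_gen_hcube[OF l'] by auto
  \<comment> \<open>Concatenating the binary digits of the coarse index \<open>k m\<close> and the
    fine index \<open>k' m\<close> gives the index in generation \<open>i + j\<close>.\<close>
  have "k m * 2 ^ j + k' m < 2 ^ (i + j)" for m
  proof -
    have "k m * 2 ^ j + k' m < Suc (k m) * 2 ^ j" using k'(1) by simp
    also have "\<dots> \<le> 2 ^ i * 2 ^ j" using k(1) by (intro mult_right_mono) (auto simp: Suc_le_eq)
    finally show ?thesis by (simp add: power_add)
  qed
  moreover have "P = hcube (\<chi> m. a $ m + real (k m * 2 ^ j + k' m) * (l / 2 ^ (i + j))) (l / 2 ^ (i + j))"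
    unfolding k'(2) by (simp add: power_add field_simps)
  ultimately show ?thesis
    unfolding dyadic_gen_hcube[OF l] by (intro image_eqI[where x = "\<lambda>m. k m * 2 ^ j + k' m"]) auto
qed

text \<open>Descending towards the lower corner of \<open>P\<close>, first \<open>i\<close> and then
  \<open>j\<close> generations, ends in a cube of generation \<open>i + j\<close> that shares this
  corner with \<open>P\<close> and therefore equals \<open>P\<close>.\<close>

lemma dyadic_gen_refine:
  fixes a :: "real ^ 'n"
  assumes l: "0 < l" and P: "P \<in> dyadic_gen (i + j) (hcube a l)"
  obtains Q where "Q \<in> dyadic_gen i (hcube a l)" "P \<in> dyadic_gen j Q"
proof -
  obtain p where p: "P = hcube p (l / 2 ^ (i + j))" using dyadic_gen_shape[OF l P] by blast
  have pP: "p \<in> P" unfolding p using l by (intro hcube_corner_mem) simp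
  then have "p \<in> hcube a l" using dyadic_gen_subset[OF l P] by blast
  then obtain b where b: "hcube b (l / 2 ^ i) \<in> dyadic_gen i (hcube a l)" "p \<in> hcube b (l / 2 ^ i)"
    using dyadic_gen_cover[OF l] by blast
  have l': "0 < l / 2 ^ i" using l by simp
  obtain b' where b': "hcube b' (l / 2 ^ i / 2 ^ j) \<in> dyadic_gen j (hcube b (l / 2 ^ i))"
    "p \<in> hcube b' (l / 2 ^ i / 2 ^ j)"
    using dyadic_gen_cover[OF l' b(2)] by blast
  have "P = hcube b' (l / 2 ^ i / 2 ^ j)"
    using dyadic_gen_eqI[OF l P dyadic_gen_trans[OF l b(1) b'(1)] pP b'(2)] .
  then show thesis using that b(1) b'(1) by blast
qed

text \<open>The cube of generation \<open>j\<close> around the centre of \<open>hcube b s\<close>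
  has side at most \<open>s / 2\<close>, so it cannot leave \<open>hcube b s\<close>. This replaces
  arbitrary cubes by dyadic ones.\<close>

lemma dyadic_gen_inside:
  fixes a b :: "real ^ 'n"
  assumes l: "0 < l" and s: "0 < s" and sub: "hcube b s \<subseteq> hcube a l" and j: "2 * l \<le> 2 ^ j * s"
  obtains Q where "Q \<in> dyadic_gen j (hcube a l)" "Q \<subseteq> hcube b s"
proof -
  define c where "c = (\<chi> i. b $ i + s / 2)"
  have "c \<in> hcube b s" using s by (auto simp: c_def hcube_def)
  then obtain q where q: "hcube q (l / 2 ^ j) \<in> dyadic_gen j (hcube a l)" "c \<in> hcube q (l / 2 ^ j)"
    using dyadic_gen_cover[OF l] sub by blast
  have t: "l / 2 ^ j \<le> s / 2" using j by (simp add: field_simps)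
  have q': "q $ i \<le> b $ i + s / 2" "b $ i + s / 2 < q $ i + l / 2 ^ j" for i
    using q(2) by (auto simp: c_def hcube_def)
  have "hcube q (l / 2 ^ j) \<subseteq> hcube b s"
  proof
    fix x assume "x \<in> hcube q (l / 2 ^ j)"
    then have x: "q $ i \<le> x $ i" "x $ i < q $ i + l / 2 ^ j" for i by (auto simp: hcube_def)
    have "b $ i \<le> x $ i \<and> x $ i < b $ i + s" for i
      using q'[of i] x[of i] t by linarith
    then show "x \<in> hcube b s" by (simp add: hcube_def)
  qed
  then show thesis using that q(1) by blast
qed

text \<open>Since \<open>\<eta> \<le> \<eta> ^ d\<close>, a bound on the volume ratio also bounds
  the side ratio, without taking roots.\<close>

lemma side_le_of_measure_le:
  fixes s t \<eta> :: real
  assumes "0 < s" "0 < t" "1 < \<eta>" "t ^ d \<le> \<eta> * s ^ d" "0 < d"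
  shows "t \<le> \<eta> * s"
proof (rule ccontr)
  assume "\<not> t \<le> \<eta> * s"
  then have "(\<eta> * s) ^ d < t ^ d" using assms by (intro power_strict_mono) auto
  moreover have "\<eta> * s ^ d \<le> \<eta> ^ d * s ^ d"
    using assms self_le_power[of \<eta> d] by (intro mult_right_mono) auto
  ultimately show False using assms(4) by (simp add: power_mult_distrib)
qed

subsection \<open>Porosity for arbitrary cubes\<close>

text \<open>The lattice does not occur, so the notion also applies to tripled cubes outside it. A
  single generation \<open>N\<close> for all cubes makes iteration possible, and
  \<open>N > 0\<close> allows the \<open>N\<close>-th root in the decay rate.\<close>

definition uniformly_porous :: "(real ^ 'n) set \<Rightarrow> bool" where
  "uniformly_porous E \<longleftrightarrow>
     (\<exists>N>0. \<forall>a l. 0 < l \<longrightarrow> (\<exists>Q\<in>dyadic_gen N (hcube a l). Q \<inter> E = {}))"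

lemma lattice_cube:
  assumes "dyadic_lattice D" "Q \<in> D"
  obtains a l where "0 < l" "Q = hcube a l"
proof -
  have "is_cube Q" using assms unfolding dyadic_lattice_def by simp
  then show thesis using that unfolding is_cube_def by blast
qed

lemma lattice_dyadic_gen:
  assumes "dyadic_lattice D" "Q \<in> D" "P \<in> dyadic_gen j Q"
  shows "P \<in> D"
proof -
  have "dyadic Q \<subseteq> D" using assms unfolding dyadic_lattice_def by simp
  then show ?thesis using assms(3) unfolding dyadic_def by blast
qed

lemma porous_imp_uniformly_porous:
  fixes E :: "(real ^ 'n) set"
  assumes D: "dyadic_lattice D" and por: "porous D E"
  shows "uniformly_porous E"
proof -
  obtain \<eta> where \<eta>: "\<eta> > 1" "\<And>R. R \<in> D \<Longrightarrow> \<exists>M. free_cube D E M \<and> M \<subseteq> R \<and>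
        measure lebesgue R \<le> \<eta> * measure lebesgue M"
    using por unfolding porous_def by blast
  \<comment> \<open>Below, \<open>Q\<close> has side more than \<open>l / 4\<close>, and the side
    \<open>s\<close> of \<open>M\<close> is at least \<open>1 / \<eta>\<close> times that, so
    \<open>l \<le> 4 * (\<eta> * s)\<close>; \<open>dyadic_gen_inside\<close> costs another factor
    2.\<close>
  obtain N where N: "8 * \<eta> < 2 ^ N" using real_arch_pow[of 2 "8 * \<eta>"] by auto
  have "\<exists>Q\<in>dyadic_gen N (hcube a l). Q \<inter> E = {}" if l: "0 < l" for a l
  proof -
    have "hcube a l \<subseteq> cbox a (\<chi> i. a $ i + l)" by (auto simp: hcube_def mem_box_cart less_imp_le)
    moreover obtain R where "R \<in> D" "cbox a (\<chi> i. a $ i + l) \<subseteq> R"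
      using D unfolding dyadic_lattice_def by (meson compact_cbox)
    ultimately have R: "R \<in> D" "hcube a l \<subseteq> R" by auto
    obtain b m where b: "0 < m" "R = hcube b m" using lattice_cube[OF D R(1)] .
    have lm: "l \<le> m"
      using hcube_subsetD[OF l, of a b m undefined] R(2) unfolding b(2) by linarith
    \<comment> \<open>The first generation of \<open>R\<close> with side at most
      \<open>l / 2\<close>, as \<open>dyadic_gen_inside\<close> requires. By minimality the side
      exceeds \<open>l / 4\<close>; generation 0 is excluded because
      \<open>l \<le> m\<close>.\<close>
    define j where "j = (LEAST j. 2 * m \<le> 2 ^ j * l)"
    obtain j0 where "2 * m / l < 2 ^ j0" using real_arch_pow[of 2 "2 * m / l"] by auto
    then have "2 * m \<le> 2 ^ j0 * l" using l by (simp add: field_simps)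
    then have j: "2 * m \<le> 2 ^ j * l" unfolding j_def by (rule LeastI)
    have "j \<noteq> 0"
    proof
      assume "j = 0"
      then show False using j lm l by simp
    qed
    then obtain j' where j': "j = Suc j'" by (cases j) auto
    have "\<not> 2 * m \<le> 2 ^ j' * l" unfolding j_def
      using not_less_Least[of j' "\<lambda>j. 2 * m \<le> 2 ^ j * l"] j' j_def by auto
    then have "2 ^ j' * l < 2 * m" by linarith
    then have jm: "2 ^ j * l < 4 * m" by (simp add: j' mult.commute)
    obtain Q where Q: "Q \<in> dyadic_gen j (hcube b m)" "Q \<subseteq> hcube a l"
      using dyadic_gen_inside[OF b(1) l _ j] R b by blast
    have QD: "Q \<in> D" using lattice_dyadic_gen[OF D R(1)] Q(1) b by blast
    obtain q where q: "Q = hcube q (m / 2 ^ j)" using dyadic_gen_shape[OF b(1) Q(1)] by blast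
    obtain M where M: "free_cube D E M" "M \<subseteq> Q" "measure lebesgue Q \<le> \<eta> * measure lebesgue M"
      using \<eta>(2)[OF QD] by blast
    have "M \<in> D" using M(1) unfolding free_cube_def ..
    then obtain c s where c: "0 < s" "M = hcube c s" using lattice_cube[OF D] by metis
    have "m / 2 ^ j \<le> \<eta> * s"
    proof (rule side_le_of_measure_le)
      have t: "0 < m / 2 ^ j" using b(1) by simp
      then show "0 < m / 2 ^ j" .
      show "(m / 2 ^ j) ^ CARD('n) \<le> \<eta> * s ^ CARD('n)"
        using M(3) unfolding q c(2) measure_hcube[OF t] measure_hcube[OF c(1)] .
      show "0 < s" "1 < \<eta>" "0 < CARD('n)" by (fact c(1) \<eta>(1) zero_less_card_finite)+
    qed
    moreover have "l < 4 * (m / 2 ^ j)" using jm by (simp add: field_simps)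
    ultimately have "l \<le> 4 * (\<eta> * s)" by linarith
    then have "2 * l \<le> (8 * \<eta>) * s" by simp
    also have "\<dots> \<le> 2 ^ N * s" using N c(1) by (intro mult_right_mono) auto
    finally have "2 * l \<le> 2 ^ N * s" .
    moreover have "hcube c s \<subseteq> hcube a l" using M(2) Q(2) c(2) by blast
    ultimately obtain P where "P \<in> dyadic_gen N (hcube a l)" "P \<subseteq> hcube c s"
      using dyadic_gen_inside[OF l c(1)] by blast
    then show ?thesis using M(1) c(2) unfolding free_cube_def by blast
  qed
  moreover have "N > 0" using N \<eta>(1) by (cases N) auto
  ultimately show ?thesis unfolding uniformly_porous_def by blast
qed

text \<open>Common end of the three converse directions: a free descendant of bounded generation has
  comparable volume, and a cube missing \<open>E\<close> serves as its own \<open>M\<close>.\<close>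

lemma porousI_gen:
  fixes E :: "(real ^ 'n) set"
  assumes D: "dyadic_lattice D" and E: "E \<noteq> {}"
    and free: "\<And>R. R \<in> D \<Longrightarrow> R \<inter> E \<noteq> {} \<Longrightarrow> \<exists>j\<le>N. \<exists>Q\<in>dyadic_gen j R. Q \<inter> E = {}"
  shows "porous D E"
proof -
  \<comment> \<open>The summand 1 gives \<open>1 < \<eta>\<close> even when
    \<open>N = 0\<close>.\<close>
  define \<eta> where "\<eta> = ((2 :: real) ^ N) ^ CARD('n) + 1"
  have \<eta>: "1 < \<eta>" by (simp add: \<eta>_def)
  have "\<exists>M. free_cube D E M \<and> M \<subseteq> R \<and> measure lebesgue R \<le> \<eta> * measure lebesgue M" if R: "R \<in> D" for R
  proof (cases "R \<inter> E = {}")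
    case True
    moreover have "1 * measure lebesgue R \<le> \<eta> * measure lebesgue R"
      using \<eta> by (intro mult_right_mono) auto
    ultimately show ?thesis using R unfolding free_cube_def mult_1 by blast
  next
    case False
    then obtain j Q where jQ: "j \<le> N" "Q \<in> dyadic_gen j R" "Q \<inter> E = {}" using free R by blast
    obtain a l where a: "0 < l" "R = hcube a l" using lattice_cube[OF D R] .
    obtain q where q: "Q = hcube q (l / 2 ^ j)" using dyadic_gen_shape a jQ(2) by blast
    have "l ^ CARD('n) = (2 ^ j) ^ CARD('n) * (l / 2 ^ j) ^ CARD('n)"
      by (simp add: power_divide)
    also have "\<dots> \<le> \<eta> * (l / 2 ^ j) ^ CARD('n)"
    proof (rule mult_right_mono)
      have "((2 :: real) ^ j) ^ CARD('n) \<le> (2 ^ N) ^ CARD('n)"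
        using jQ(1) by (intro power_mono power_increasing) auto
      then show "(2 ^ j) ^ CARD('n) \<le> \<eta>" unfolding \<eta>_def by linarith
    qed (use a in auto)
    finally have "measure lebesgue R \<le> \<eta> * measure lebesgue Q"
      using a q by (simp add: measure_hcube)
    moreover have "Q \<subseteq> R" using dyadic_gen_subset[OF a(1)] jQ(2) a(2) by blast
    ultimately show ?thesis
      using jQ(3) lattice_dyadic_gen[OF D R jQ(2)] unfolding free_cube_def by blast
  qed
  with E \<eta> show ?thesis unfolding porous_def by (intro conjI exI[of _ \<eta>] ballI)
qed

section \<open>Counting the cubes of one generation that meet the set\<close>

definition meeting_gen :: "(real ^ 'n) set \<Rightarrow> nat \<Rightarrow> (real ^ 'n) set \<Rightarrow> (real ^ 'n) set set" where
  "meeting_gen E j R = {Q \<in> dyadic_gen j R. Q \<inter> E \<noteq> {}}"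

lemma meeting_gen_subset: "meeting_gen E j R \<subseteq> dyadic_gen j R"
  by (auto simp: meeting_gen_def)

lemma meeting_gen_shape:
  "0 < l \<Longrightarrow> Q \<in> meeting_gen E j (hcube a l) \<Longrightarrow> \<exists>b. Q = hcube b (l / 2 ^ j)"
  using dyadic_gen_shape meeting_gen_subset by blast

lemma finite_meeting_gen: "0 < l \<Longrightarrow> finite (meeting_gen E j (hcube a l))"
  using finite_subset[OF meeting_gen_subset finite_dyadic_gen] .

lemma dyadic_meeting_eq: "dyadic_meeting E R = (\<Union>j. meeting_gen E j R)"
  by (auto simp: dyadic_meeting_def dyadic_def meeting_gen_def)

lemma card_meeting_gen_le:
  fixes a :: "real ^ 'n"
  assumes "0 < l"
  shows "card (meeting_gen E j (hcube a l)) \<le> 2 ^ (j * CARD('n))"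
  using card_mono[OF finite_dyadic_gen[OF assms] meeting_gen_subset, of E j a]
  by (simp add: dyadic_gen_tiling(1)[OF assms])

lemma card_meeting_gen_less_iff:
  fixes a :: "real ^ 'n"
  assumes "0 < l"
  shows "card (meeting_gen E j (hcube a l)) < 2 ^ (j * CARD('n)) \<longleftrightarrow>
    (\<exists>Q\<in>dyadic_gen j (hcube a l). Q \<inter> E = {})"
proof
  assume "card (meeting_gen E j (hcube a l)) < 2 ^ (j * CARD('n))"
  then have "meeting_gen E j (hcube a l) \<noteq> dyadic_gen j (hcube a l)"
    using dyadic_gen_tiling(1)[OF assms, of j a] by auto
  then show "\<exists>Q\<in>dyadic_gen j (hcube a l). Q \<inter> E = {}" by (auto simp: meeting_gen_def)
next
  assume "\<exists>Q\<in>dyadic_gen j (hcube a l). Q \<inter> E = {}"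
  then have "meeting_gen E j (hcube a l) \<subset> dyadic_gen j (hcube a l)" by (auto simp: meeting_gen_def)
  from psubset_card_mono[OF finite_dyadic_gen[OF assms] this]
  show "card (meeting_gen E j (hcube a l)) < 2 ^ (j * CARD('n))"
    by (simp add: dyadic_gen_tiling(1)[OF assms])
qed

text \<open>With \<open>\<gamma> = 2 powr - \<delta>\<close> the bound is
  \<open>C * 2 powr (j * (d - \<delta>))\<close>, uniformly over all cubes. For nonempty
  \<open>E\<close> this bounds its Assouad dimension by \<open>d - \<delta>\<close>.\<close>

definition meeting_bound :: "(real ^ 'n) set \<Rightarrow> real \<Rightarrow> real \<Rightarrow> bool" where
  "meeting_bound E C \<gamma> \<longleftrightarrow> 0 < C \<and> 0 < \<gamma> \<and> \<gamma> < 1 \<and>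
    (\<forall>a l j. 0 < l \<longrightarrow> real (card (meeting_gen E j (hcube a l))) \<le> C * \<gamma> ^ j * (2 ^ j) ^ CARD('n))"

text \<open>Cubes of generation \<open>j + N\<close> meeting \<open>E\<close> descend from cubes of
  generation \<open>j\<close> meeting \<open>E\<close>, and each of these has at most
  \<open>B - 1\<close> such descendants out of \<open>B\<close>. So a fixed factor is gained every
  \<open>N\<close> generations.\<close>

lemma uniformly_porous_imp_meeting_bound:
  fixes E :: "(real ^ 'n) set"
  assumes "uniformly_porous E"
  obtains C \<gamma> where "meeting_bound E C \<gamma>"
proof -
  obtain N where N: "N > 0"
    and free: "\<And>(a :: real ^ 'n) l. 0 < l \<Longrightarrow> \<exists>Q\<in>dyadic_gen N (hcube a l). Q \<inter> E = {}"
    using assms unfolding uniformly_porous_def by blast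
  define B where "B = ((2 :: real) ^ N) ^ CARD('n)"
  have B: "1 \<le> B" by (simp add: B_def)
  \<comment> \<open>The ratio in question is \<open>1 - 1 / B\<close>; the factor 2 makes
    \<open>\<rho>\<close> positive from \<open>1 \<le> B\<close> alone.\<close>
  define \<rho> where "\<rho> = 1 - 1 / (2 * B)"
  have \<rho>: "0 < \<rho>" "\<rho> < 1" using B by (auto simp: \<rho>_def)
  have \<rho>B: "B - 1 \<le> \<rho> * B" using B by (simp add: \<rho>_def field_simps)
  define \<gamma> where "\<gamma> = root N \<rho>"
  have \<gamma>: "0 < \<gamma>" "\<gamma> < 1" "\<gamma> ^ N = \<rho>" using \<rho> N by (auto simp: \<gamma>_def)
  have one: "real (card (meeting_gen E N (hcube a l))) \<le> B - 1" if "0 < l" for a l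
  proof -
    have "card (meeting_gen E N (hcube a l)) < 2 ^ (N * CARD('n))"
      using card_meeting_gen_less_iff[OF that] free[OF that] by blast
    then have "real (card (meeting_gen E N (hcube a l))) + 1 \<le> real (2 ^ (N * CARD('n)))"
      by (metis Suc_leI of_nat_Suc of_nat_mono add.commute)
    then show ?thesis by (simp add: B_def power_mult)
  qed
  have step: "real (card (meeting_gen E (j + N) (hcube a l)))
      \<le> real (card (meeting_gen E j (hcube a l))) * (B - 1)" if l: "0 < l" for j a l
  proof -
    have "meeting_gen E (j + N) (hcube a l) \<subseteq> (\<Union>Q\<in>meeting_gen E j (hcube a l). meeting_gen E N Q)"
    proof
      fix P assume P: "P \<in> meeting_gen E (j + N) (hcube a l)"
      then obtain Q where Q: "Q \<in> dyadic_gen j (hcube a l)" "P \<in> dyadic_gen N Q"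
        using dyadic_gen_refine[OF l, of P j N a] unfolding meeting_gen_def by blast
      obtain q where q: "Q = hcube q (l / 2 ^ j)" using dyadic_gen_shape[OF l Q(1)] by blast
      have "P \<subseteq> Q" using dyadic_gen_subset[of "l / 2 ^ j" P N q] Q(2) q l by auto
      then show "P \<in> (\<Union>Q\<in>meeting_gen E j (hcube a l). meeting_gen E N Q)"
        using P Q unfolding meeting_gen_def by blast
    qed
    moreover have fin: "finite (meeting_gen E N Q)" if "Q \<in> meeting_gen E j (hcube a l)" for Q
    proof -
      obtain q where "Q = hcube q (l / 2 ^ j)"
        using meeting_gen_shape[OF l \<open>Q \<in> _\<close>] by blast
      then show ?thesis using l by (simp add: finite_meeting_gen)
    qed
    ultimately have "card (meeting_gen E (j + N) (hcube a l))
        \<le> card (\<Union>Q\<in>meeting_gen E j (hcube a l). meeting_gen E N Q)"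
      using finite_meeting_gen[OF l] by (intro card_mono finite_UN_I) auto
    also have "\<dots> \<le> (\<Sum>Q\<in>meeting_gen E j (hcube a l). card (meeting_gen E N Q))"
      using finite_meeting_gen[OF l] by (rule card_UN_le)
    finally have "real (card (meeting_gen E (j + N) (hcube a l)))
        \<le> (\<Sum>Q\<in>meeting_gen E j (hcube a l). real (card (meeting_gen E N Q)))"
      by (metis of_nat_le_iff of_nat_sum)
    also have "\<dots> \<le> (\<Sum>Q\<in>meeting_gen E j (hcube a l). B - 1)"
    proof (rule sum_mono)
      fix Q assume "Q \<in> meeting_gen E j (hcube a l)"
      then obtain q where "Q = hcube q (l / 2 ^ j)"
        using meeting_gen_shape[OF l] by blast
      then show "real (card (meeting_gen E N Q)) \<le> B - 1" using one l by simp
    qed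
    finally show ?thesis by simp
  qed
  \<comment> \<open>Strong induction with steps of length \<open>N\<close>. For \<open>j < N\<close>
    the trivial count suffices: \<open>\<gamma> ^ j \<ge> \<gamma> ^ N = \<rho>\<close>, and the
    constant \<open>1 / \<rho>\<close> absorbs this loss.\<close>
  have "real (card (meeting_gen E j (hcube a l))) \<le> (1 / \<rho>) * \<gamma> ^ j * (2 ^ j) ^ CARD('n)" if l: "0 < l" for a l j
  proof (induction j rule: less_induct)
    case (less j)
    show ?case
    proof (cases "j < N")
      case True
      have "\<rho> \<le> \<gamma> ^ j" using \<gamma> True power_decreasing[of j N \<gamma>] by simp
      then have "1 \<le> 1 / \<rho> * \<gamma> ^ j" using \<rho> by (simp add: field_simps)
      then have "1 * (2 ^ j) ^ CARD('n) \<le> 1 / \<rho> * \<gamma> ^ j * (2 ^ j) ^ CARD('n)"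
        by (intro mult_right_mono) auto
      moreover have "real (card (meeting_gen E j (hcube a l))) \<le> real (2 ^ (j * CARD('n)))"
        using card_meeting_gen_le[OF l] by (intro of_nat_mono)
      ultimately show ?thesis by (simp add: power_mult)
    next
      case False
      then obtain i where i: "j = i + N" by (metis le_add_diff_inverse2 not_less)
      have "real (card (meeting_gen E j (hcube a l)))
          \<le> real (card (meeting_gen E i (hcube a l))) * (B - 1)"
        unfolding i by (rule step[OF l])
      also have "\<dots> \<le> ((1 / \<rho>) * \<gamma> ^ i * (2 ^ i) ^ CARD('n)) * (\<rho> * B)"
        using less[of i] i N \<rho>B B \<rho> \<gamma> by (intro mult_mono) auto
      also have "\<dots> = (1 / \<rho>) * \<gamma> ^ j * (2 ^ j) ^ CARD('n)"
        by (simp add: i B_def power_add \<gamma>(3)[symmetric] power_mult_distrib)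
      finally show ?thesis .
    qed
  qed
  then have "meeting_bound E (1 / \<rho>) \<gamma>" using \<rho> \<gamma> unfolding meeting_bound_def by simp
  then show thesis using that by blast
qed

section \<open>Sums over all generations and the power-sum condition\<close>

lemma infsum_ennreal_le:
  fixes f :: "'a \<Rightarrow> ennreal"
  assumes "\<And>F. finite F \<Longrightarrow> F \<subseteq> A \<Longrightarrow> sum f F \<le> b"
  shows "infsum f A \<le> b"
  by (subst nonneg_infsum_complete) (auto intro!: SUP_least assms)

lemma sum_le_infsum_ennreal:
  fixes f :: "'a \<Rightarrow> ennreal"
  assumes "finite F" "F \<subseteq> A"
  shows "sum f F \<le> infsum f A"
  by (subst nonneg_infsum_complete) (auto intro!: SUP_upper assms)

text \<open>For upper bounds subadditivity over the generations is enough; it holds because the sum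
  over the intersection is nonnegative.\<close>

lemma sum_UN_lessThan_le_ennreal:
  fixes f :: "'a \<Rightarrow> ennreal" and A :: "nat \<Rightarrow> 'a set"
  assumes "\<And>j. finite (A j)"
  shows "sum f (\<Union>j<J. A j) \<le> (\<Sum>j<J. sum f (A j))"
proof (induction J)
  case (Suc J)
  have "sum f (\<Union>j<Suc J. A j) = sum f ((\<Union>j<J. A j) \<union> A J)"
    by (simp add: lessThan_Suc Un_commute)
  also have "\<dots> \<le> sum f ((\<Union>j<J. A j) \<union> A J) + sum f ((\<Union>j<J. A j) \<inter> A J)" by simp
  also have "\<dots> = sum f (\<Union>j<J. A j) + sum f (A J)"
    using assms by (intro sum.union_inter) auto
  finally show ?case using Suc by (simp add: add_right_mono order_trans)
qed simp

text \<open>All cubes of generation \<open>j\<close> together contribute a factor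
  \<open>2 powr \<alpha>\<close> per generation. If only a fraction \<open>C * \<gamma> ^ j\<close>
  of them is counted, the ratio becomes \<open>2 powr \<alpha> * \<gamma>\<close>.\<close>

lemma scaled_powr:
  fixes l :: real
  assumes "0 < l"
  shows "(2 ^ j) ^ d * (l / 2 ^ j) powr (real d - \<alpha>) = l powr (real d - \<alpha>) * (2 powr \<alpha>) ^ j"
proof -
  have "(2 ^ j) powr \<alpha> = (2 powr \<alpha>) ^ j"
    by (simp add: powr_realpow[symmetric] powr_powr mult.commute)
  moreover have "(2 ^ j) powr (real d - \<alpha>) = (2 ^ j) ^ d / (2 ^ j) powr \<alpha>"
    by (simp add: powr_diff powr_realpow)
  ultimately show ?thesis using assms by (simp add: powr_divide)
qed

lemma measure_hcube_powr:
  fixes b :: "real ^ 'n"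
  assumes "0 < s"
  shows "measure lebesgue (hcube b s) powr (1 - \<alpha> / real CARD('n)) = s powr (real CARD('n) - \<alpha>)"
  using assms by (simp add: measure_hcube powr_realpow[symmetric] powr_powr right_diff_distrib)

text \<open>Stated for any \<open>w\<close> of the right scaling, so that one geometric series
  serves both the powers of the volume, with \<open>K = 1\<close>, and the distance weights.\<close>

lemma infsum_dyadic_meeting_le:
  fixes E :: "(real ^ 'n) set"
  assumes bd: "meeting_bound E C \<gamma>" and r: "2 powr \<alpha> * \<gamma> < 1" and K: "0 \<le> K" and l: "0 < l"
    and w: "\<And>b s. 0 < s \<Longrightarrow> w (hcube b s) \<le> ennreal (K * s powr (real CARD('n) - \<alpha>))"
  shows "(\<Sum>\<^sub>\<infinity>Q\<in>dyadic_meeting E (hcube a l). w Q)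
    \<le> ennreal (K * C / (1 - 2 powr \<alpha> * \<gamma>) * l powr (real CARD('n) - \<alpha>))"
proof (rule infsum_ennreal_le)
  let ?R = "hcube a l" and ?r = "2 powr \<alpha> * \<gamma>" and ?L = "l powr (real CARD('n) - \<alpha>)"
  have C: "0 < C" "0 < \<gamma>" using bd by (auto simp: meeting_bound_def)
  fix F assume F: "finite F" "F \<subseteq> dyadic_meeting E ?R"
  then have "\<forall>Q\<in>F. \<exists>j. Q \<in> meeting_gen E j ?R" unfolding dyadic_meeting_eq by auto
  then obtain g where g: "\<forall>Q\<in>F. Q \<in> meeting_gen E (g Q) ?R" unfolding bchoice_iff ..
  \<comment> \<open>A finite family reaches only finitely many generations, all below
    \<open>J\<close>. For empty \<open>F\<close> the value of \<open>Max\<close> is arbitrary, but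
    the inclusion in the union is then trivial.\<close>
  define J where "J = Suc (Max (g ` F))"
  have "g Q \<in> {..<J}" if "Q \<in> F" for Q using F(1) that by (simp add: J_def less_Suc_eq_le)
  then have "F \<subseteq> (\<Union>j<J. meeting_gen E j ?R)" using g by (intro subsetI UN_I[of "g _"]) auto
  then have "sum w F \<le> sum w (\<Union>j<J. meeting_gen E j ?R)"
    using finite_meeting_gen[OF l] by (intro sum_mono2) auto
  also have "\<dots> \<le> (\<Sum>j<J. sum w (meeting_gen E j ?R))"
    using finite_meeting_gen[OF l] by (rule sum_UN_lessThan_le_ennreal)
  also have "\<dots> \<le> (\<Sum>j<J. ennreal (K * C * ?L * ?r ^ j))"
  proof (rule sum_mono)
    fix j
    have s: "0 < l / 2 ^ j" using l by simp
    have "sum w (meeting_gen E j ?R)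
        \<le> (\<Sum>Q\<in>meeting_gen E j ?R. ennreal (K * (l / 2 ^ j) powr (real CARD('n) - \<alpha>)))"
    proof (rule sum_mono)
      fix Q assume "Q \<in> meeting_gen E j ?R"
      then obtain q where "Q = hcube q (l / 2 ^ j)"
        using meeting_gen_shape[OF l] by blast
      then show "w Q \<le> ennreal (K * (l / 2 ^ j) powr (real CARD('n) - \<alpha>))" using w[OF s] by simp
    qed
    also have "\<dots> = ennreal (card (meeting_gen E j ?R) * (K * (l / 2 ^ j) powr (real CARD('n) - \<alpha>)))"
      by (simp add: ennreal_mult' ennreal_of_nat_eq_real_of_nat)
    also have "\<dots> \<le> ennreal ((C * \<gamma> ^ j * (2 ^ j) ^ CARD('n)) * (K * (l / 2 ^ j) powr (real CARD('n) - \<alpha>)))"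
      using bd l K unfolding meeting_bound_def by (intro ennreal_leI mult_right_mono) auto
    also have "(C * \<gamma> ^ j * (2 ^ j) ^ CARD('n)) * (K * (l / 2 ^ j) powr (real CARD('n) - \<alpha>)) =
        C * \<gamma> ^ j * K * ((2 ^ j) ^ CARD('n) * (l / 2 ^ j) powr (real CARD('n) - \<alpha>))"
      by (simp only: ac_simps)
    also have "\<dots> = K * C * ?L * ?r ^ j"
      unfolding scaled_powr[OF l] by (simp only: power_mult_distrib ac_simps)
    finally show "sum w (meeting_gen E j ?R) \<le> ennreal (K * C * ?L * ?r ^ j)" .
  qed
  also have "\<dots> = ennreal (\<Sum>j<J. K * C * ?L * ?r ^ j)"
    using K C by (intro sum_ennreal) auto
  also have "\<dots> \<le> ennreal (K * C / (1 - ?r) * ?L)"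
  proof (rule ennreal_leI)
    have "(\<Sum>j<J. ?r ^ j) \<le> 1 / (1 - ?r)"
    proof -
      have "(\<Sum>j<J. ?r ^ j) \<le> (\<Sum>j. ?r ^ j)"
        using r C by (intro sum_le_suminf summable_geometric) auto
      then show ?thesis using r C by (simp add: suminf_geometric)
    qed
    then have "K * C * ?L * (\<Sum>j<J. ?r ^ j) \<le> K * C * ?L * (1 / (1 - ?r))"
      using K C by (intro mult_left_mono) auto
    then show "(\<Sum>j<J. K * C * ?L * ?r ^ j) \<le> K * C / (1 - ?r) * ?L"
      by (simp add: sum_distrib_left mult_ac)
  qed
  finally show "sum w F \<le> ennreal (K * C / (1 - ?r) * ?L)" .
qed

text \<open>One generation of the sum is enough: if all its cubes met \<open>E\<close>, it would
  contribute \<open>(2 powr \<alpha>) ^ j\<close> times the power of the volume of \<open>R\<close>,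
  which exceeds the bound as soon as \<open>(2 powr \<alpha>) ^ j > \<zeta>\<close>.\<close>

lemma sum_condition_imp_porous:
  fixes E :: "(real ^ 'n) set"
  assumes D: "dyadic_lattice D" and E: "E \<noteq> {}" and \<alpha>: "\<alpha> > 0" and \<zeta>: "\<zeta> > 0"
    and sum: "\<And>R. R \<in> D \<Longrightarrow>
      (\<Sum>\<^sub>\<infinity>Q\<in>dyadic_meeting E R. ennreal (measure lebesgue Q powr (1 - \<alpha> / real CARD('n))))
        \<le> ennreal (\<zeta> * measure lebesgue R powr (1 - \<alpha> / real CARD('n)))"
  shows "porous D E"
proof -
  have "(1 :: real) < 2 powr \<alpha>" using \<alpha> by simp
  then obtain j where j: "\<zeta> < (2 powr \<alpha>) ^ j" using real_arch_pow by blast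
  have "\<exists>Q\<in>dyadic_gen j R. Q \<inter> E = {}" if R: "R \<in> D" for R
  proof -
    let ?p = "real CARD('n) - \<alpha>"
    obtain a l where l: "0 < l" and Ra: "R = hcube a l" using lattice_cube[OF D R] .
    have s: "0 < l / 2 ^ j" using l by simp
    let ?n = "card (meeting_gen E j R)"
    have "ennreal (?n * (l / 2 ^ j) powr ?p)
        = (\<Sum>Q\<in>meeting_gen E j R. ennreal ((l / 2 ^ j) powr ?p))"
      by (simp add: ennreal_mult' ennreal_of_nat_eq_real_of_nat)
    also have "\<dots> = (\<Sum>Q\<in>meeting_gen E j R. ennreal (measure lebesgue Q powr (1 - \<alpha> / real CARD('n))))"
    proof (rule sum.cong)
      fix Q assume "Q \<in> meeting_gen E j R"
      then obtain q where "Q = hcube q (l / 2 ^ j)"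
        using meeting_gen_shape[OF l] Ra by blast
      then show "ennreal ((l / 2 ^ j) powr ?p) = ennreal (measure lebesgue Q powr (1 - \<alpha> / real CARD('n)))"
        by (simp add: measure_hcube_powr[OF s])
    qed simp
    also have "\<dots> \<le> (\<Sum>\<^sub>\<infinity>Q\<in>dyadic_meeting E R. ennreal (measure lebesgue Q powr (1 - \<alpha> / real CARD('n))))"
      using finite_meeting_gen[OF l] unfolding Ra dyadic_meeting_eq by (intro sum_le_infsum_ennreal) auto
    also have "\<dots> \<le> ennreal (\<zeta> * l powr ?p)"
      using sum[OF R] unfolding Ra measure_hcube_powr[OF l] .
    finally have "?n * (l / 2 ^ j) powr ?p \<le> \<zeta> * l powr ?p"
      using \<zeta> by (simp add: ennreal_le_iff)
    also have "\<dots> < (2 powr \<alpha>) ^ j * l powr ?p"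
      using j l by (intro mult_strict_right_mono) auto
    also have "\<dots> = (2 ^ j) ^ CARD('n) * (l / 2 ^ j) powr ?p"
      unfolding scaled_powr[OF l] by simp
    finally have "real ?n < (2 ^ j) ^ CARD('n)"
      using s by (subst (asm) mult_less_cancel_right_pos) auto
    then have "real ?n < real (2 ^ (j * CARD('n)))" by (simp add: power_mult)
    then have "?n < 2 ^ (j * CARD('n))" unfolding of_nat_less_iff .
    then show ?thesis using card_meeting_gen_less_iff[OF l] unfolding Ra by blast
  qed
  then show ?thesis by (intro porousI_gen[OF D E, of j]) blast
qed

subsection \<open>Well-sparse families\<close>

text \<open>A cube \<open>R\<close> meeting \<open>E\<close> belongs to the family as its own
  generation 0. Its \<open>M R\<close> may lie outside the lattice, but contains a descendant of
  \<open>R\<close> of a generation depending only on \<open>c\<close>.\<close>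

lemma well_sparse_imp_porous:
  fixes E :: "(real ^ 'n) set"
  assumes D: "dyadic_lattice D" and E: "E \<noteq> {}" and ws: "well_sparse D (lattice_meeting D E) E"
  shows "porous D E"
proof -
  obtain c M where c: "c > 1" and M: "\<And>Q. Q \<in> lattice_meeting D E \<Longrightarrow> is_cube (M Q) \<and> M Q \<subseteq> Q \<and>
      measure lebesgue Q \<le> c * measure lebesgue (M Q) \<and> M Q \<inter> E = {}"
    using ws unfolding well_sparse_def by meson
  obtain j where j: "2 * c < 2 ^ j" using real_arch_pow[of 2 "2 * c"] by auto
  have "\<exists>Q\<in>dyadic_gen j R. Q \<inter> E = {}" if R: "R \<in> D" "R \<inter> E \<noteq> {}" for R
  proof -
    obtain a l where l: "0 < l" and Ra: "R = hcube a l" using lattice_cube[OF D R(1)] .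
    have "R \<in> dyadic_gen 0 R" unfolding Ra dyadic_gen_hcube[OF l]
      by (intro image_eqI[where x = "\<lambda>_. 0"]) auto
    then have "R \<in> lattice_meeting D E"
      using R unfolding lattice_meeting_def dyadic_meeting_def dyadic_def by blast
    then obtain b s where s: "0 < s" "M R = hcube b s" and sub: "hcube b s \<subseteq> R"
      and meas: "measure lebesgue R \<le> c * measure lebesgue (hcube b s)" and free: "hcube b s \<inter> E = {}"
      using M[of R] unfolding is_cube_def by metis
    have "l \<le> c * s"
      using meas unfolding Ra measure_hcube[OF l] measure_hcube[OF s(1)]
      by (rule side_le_of_measure_le[OF s(1) l c _ zero_less_card_finite])
    then have "2 * l \<le> 2 * c * s" by simp
    also have "\<dots> \<le> 2 ^ j * s" using j s(1) by (intro mult_right_mono) auto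
    finally obtain Q where "Q \<in> dyadic_gen j (hcube a l)" "Q \<subseteq> hcube b s"
      using dyadic_gen_inside[OF l s(1)] sub Ra by blast
    then show ?thesis using free Ra by blast
  qed
  then show ?thesis by (intro porousI_gen[OF D E, of j]) blast
qed

section \<open>Nested lattice cubes and the disjoint choice of free cubes\<close>

lemma dyadic_gen_nested:
  fixes a :: "real ^ 'n"
  assumes l: "0 < l" and Q: "Q \<in> dyadic_gen (i + k) (hcube a l)" "Q' \<in> dyadic_gen i (hcube a l)"
    and x: "x \<in> Q" "x \<in> Q'"
  shows "Q \<in> dyadic_gen k Q'"
proof -
  obtain P where P: "P \<in> dyadic_gen i (hcube a l)" "Q \<in> dyadic_gen k P"
    using dyadic_gen_refine[OF l Q(1)] .
  obtain p where p: "P = hcube p (l / 2 ^ i)" using dyadic_gen_shape[OF l P(1)] by blast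
  have "Q \<subseteq> P" using dyadic_gen_subset[of "l / 2 ^ i" Q k p] P(2) l p by simp
  then have "P = Q'" using dyadic_gen_eqI[OF l P(1) Q(2)] x by blast
  then show ?thesis using P(2) by simp
qed

text \<open>A common ancestor places both cubes in one hierarchy of grids, where the finer of two
  intersecting cubes descends from the coarser.\<close>

lemma lattice_nested:
  fixes D :: "(real ^ 'n) set set"
  assumes D: "dyadic_lattice D" and Q: "Q \<in> D" "Q' \<in> D" and x: "x \<in> Q" "x \<in> Q'"
  shows "(\<exists>k. Q \<in> dyadic_gen k Q') \<or> (\<exists>k. Q' \<in> dyadic_gen k Q)"
proof -
  obtain R where R: "R \<in> D" "Q \<in> dyadic R" "Q' \<in> dyadic R"
    using D Q unfolding dyadic_lattice_def by meson
  obtain a l where l: "0 < l" and Ra: "R = hcube a l" using lattice_cube[OF D R(1)] .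
  obtain i i' where i: "Q \<in> dyadic_gen i R" "Q' \<in> dyadic_gen i' R"
    using R(2,3) unfolding dyadic_def by blast
  show ?thesis
  proof (cases "i' \<le> i")
    case True
    then obtain k where "i = i' + k" using le_Suc_ex by blast
    then show ?thesis using dyadic_gen_nested[OF l, of Q i' k a Q' x] i x unfolding Ra by blast
  next
    case False
    then obtain k where "i' = i + k" using le_Suc_ex[of i i'] by auto
    then show ?thesis using dyadic_gen_nested[OF l, of Q' i k a Q x] i x unfolding Ra by blast
  qed
qed

lemma hcube_subset_eqI:
  fixes a b :: "real ^ 'n"
  assumes "0 < l" "hcube a l \<subseteq> hcube b l"
  shows "a = b"
  using hcube_subsetD[OF assms] by (auto simp: vec_eq_iff intro: antisym)

lemma uniformly_porous_imp_well_sparse: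
  fixes E :: "(real ^ 'n) set"
  assumes D: "dyadic_lattice D" and por: "uniformly_porous E"
  shows "well_sparse D (lattice_meeting D E) E"
proof -
  let ?S = "lattice_meeting D E"
  obtain N where N: "N > 0"
    and free: "\<And>(a :: real ^ 'n) l. 0 < l \<Longrightarrow> \<exists>Q\<in>dyadic_gen N (hcube a l). Q \<inter> E = {}"
    using por unfolding uniformly_porous_def by blast
  have S: "Q \<in> D" "Q \<inter> E \<noteq> {}" if Q: "Q \<in> ?S" for Q
  proof -
    have "Q \<inter> E \<noteq> {} \<and> (\<exists>R\<in>D. \<exists>j. Q \<in> dyadic_gen j R)"
      using Q unfolding lattice_meeting_def dyadic_meeting_def dyadic_def by blast
    then show "Q \<in> D" "Q \<inter> E \<noteq> {}" using lattice_dyadic_gen[OF D] by blast+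
  qed
  \<comment> \<open>\<open>g\<close> is the least generation in which \<open>Q\<close> has a free
    descendant; uniform porosity bounds it by \<open>N\<close>.\<close>
  have "\<exists>g p s. 0 < s \<and> hcube p s \<in> dyadic_gen g Q \<and> hcube p s \<inter> E = {} \<and> g \<le> N \<and>
      (\<forall>k P. P \<in> dyadic_gen k Q \<longrightarrow> P \<inter> E = {} \<longrightarrow> g \<le> k)" if Q: "Q \<in> ?S" for Q
  proof -
    obtain a l where l: "0 < l" and Qa: "Q = hcube a l" using lattice_cube[OF D S(1)[OF Q]] .
    define g where "g = (LEAST g. \<exists>P\<in>dyadic_gen g Q. P \<inter> E = {})"
    have fr: "\<exists>P\<in>dyadic_gen N Q. P \<inter> E = {}" using free[OF l] Qa by blast
    then have "\<exists>P\<in>dyadic_gen g Q. P \<inter> E = {}" unfolding g_def by (rule LeastI)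
    then obtain p where "hcube p (l / 2 ^ g) \<in> dyadic_gen g Q" "hcube p (l / 2 ^ g) \<inter> E = {}"
      using dyadic_gen_shape[OF l] Qa by blast
    moreover have "g \<le> N" using fr unfolding g_def by (rule Least_le)
    moreover have "\<forall>k P. P \<in> dyadic_gen k Q \<longrightarrow> P \<inter> E = {} \<longrightarrow> g \<le> k"
      unfolding g_def by (auto intro!: Least_le)
    ultimately show ?thesis using l by (intro exI[of _ g] exI[of _ p] exI[of _ "l / 2 ^ g"]) simp
  qed
  then obtain g p s where sel: "\<And>Q. Q \<in> ?S \<Longrightarrow> 0 < s Q \<and> hcube (p Q) (s Q) \<in> dyadic_gen (g Q) Q \<and>
      hcube (p Q) (s Q) \<inter> E = {} \<and> g Q \<le> N \<and>
      (\<forall>k P. P \<in> dyadic_gen k Q \<longrightarrow> P \<inter> E = {} \<longrightarrow> g Q \<le> k)"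
    by metis
  define P where "P = (\<lambda>Q. hcube (p Q) (s Q))"
  \<comment> \<open>The diagonal cell with index \<open>g Q\<close> in generation \<open>N\<close>
    of \<open>P Q\<close>. It exists because \<open>g Q \<le> N < 2 ^ N\<close>, and it separates
    different cubes \<open>Q\<close> that share the same \<open>P Q\<close>.\<close>
  define M where "M = (\<lambda>Q. hcube (\<chi> i. p Q $ i + real (g Q) * (s Q / 2 ^ N)) (s Q / 2 ^ N))"
  have MP: "M Q \<in> dyadic_gen N (P Q)" if Q: "Q \<in> ?S" for Q
  proof -
    have "0 < s Q" "g Q \<le> N" using sel[OF Q] by auto
    moreover have "g Q < 2 ^ N" using le_less_trans[OF \<open>g Q \<le> N\<close> less_exp] .
    ultimately show ?thesis unfolding M_def P_def
      by (subst dyadic_gen_hcube) (auto intro!: image_eqI[where x = "\<lambda>_. g Q"])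
  qed
  have Msub: "M Q \<subseteq> P Q" if Q: "Q \<in> ?S" for Q
    using MP[OF Q] dyadic_gen_subset sel[OF Q] unfolding P_def by blast
  have side: "\<exists>a. Q = hcube a (2 ^ g Q * s Q)" and Psub: "P Q \<subseteq> Q" if Q: "Q \<in> ?S" for Q
  proof -
    obtain a l where l: "0 < l" and Qa: "Q = hcube a l" using lattice_cube[OF D S(1)[OF Q]] .
    have PQ: "hcube (p Q) (s Q) \<in> dyadic_gen (g Q) (hcube a l)" using sel[OF Q] Qa by simp
    then obtain b where "hcube (p Q) (s Q) = hcube b (l / 2 ^ g Q)" using dyadic_gen_shape[OF l] by blast
    then have "s Q = l / 2 ^ g Q" using hcube_eq_iff[of "s Q" "l / 2 ^ g Q"] sel[OF Q] l by auto
    then have "l = 2 ^ g Q * s Q" by simp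
    then show "\<exists>a. Q = hcube a (2 ^ g Q * s Q)" using Qa by blast
    show "P Q \<subseteq> Q" unfolding P_def using dyadic_gen_subset[OF l PQ] Qa by simp
  qed
  have cmp: "P Q' \<in> dyadic_gen k Q \<Longrightarrow> g Q \<le> k" if "Q \<in> ?S" "Q' \<in> ?S" for Q Q' k
    using sel[OF that(1)] sel[OF that(2)] unfolding P_def by blast
  \<comment> \<open>Lattice cubes with a common point are nested, and \<open>Q\<close> cannot lie
    inside \<open>P Q'\<close> because \<open>Q\<close> meets \<open>E\<close> and
    \<open>P Q'\<close> does not.\<close>
  have desc: "\<exists>k. P Q' \<in> dyadic_gen k Q" if Q: "Q \<in> ?S" "Q' \<in> ?S" "x \<in> Q" "x \<in> P Q'" for Q Q' x
  proof -
    have PD: "P Q' \<in> D" using lattice_dyadic_gen[OF D S(1)[OF Q(2)]] sel[OF Q(2)] unfolding P_def by blast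
    have "False" if k: "Q \<in> dyadic_gen k (P Q')" for k
    proof -
      have "Q \<subseteq> P Q'" using k sel[OF Q(2)] dyadic_gen_subset unfolding P_def by blast
      then show False using S(2)[OF Q(1)] sel[OF Q(2)] unfolding P_def by blast
    qed
    then show ?thesis using lattice_nested[OF D S(1)[OF Q(1)] PD Q(3,4)] by blast
  qed
  \<comment> \<open>As a free descendant of \<open>Q\<close>, the cube \<open>P Q'\<close> has
    generation at least \<open>g Q\<close> in \<open>Q\<close>, so its side is at most that of
    \<open>P Q\<close>. Applied both ways this yields equal sides.\<close>
  have le: "s Q' \<le> s Q" if Q: "Q \<in> ?S" "Q' \<in> ?S" "x \<in> Q" "x \<in> P Q'" for Q Q' x
  proof -
    obtain k where k: "P Q' \<in> dyadic_gen k Q" using desc[OF Q] by blast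
    obtain a where a: "Q = hcube a (2 ^ g Q * s Q)" using side[OF Q(1)] by blast
    have l: "0 < 2 ^ g Q * s Q" using sel[OF Q(1)] by simp
    obtain b where b: "P Q' = hcube b (2 ^ g Q * s Q / 2 ^ k)"
      using dyadic_gen_shape[OF l, of "P Q'" k a] k a by auto
    have "s Q' = 2 ^ g Q * s Q / 2 ^ k"
      using b hcube_eq_iff[of "s Q'" "2 ^ g Q * s Q / 2 ^ k"] sel[OF Q(2)] l unfolding P_def by auto
    also have "\<dots> \<le> 2 ^ k * s Q / 2 ^ k"
      using cmp[OF Q(1,2) k] sel[OF Q(1)] by (intro divide_right_mono mult_right_mono power_increasing) auto
    finally show ?thesis by simp
  qed
  have disj: "Q = Q'" if Q: "Q \<in> ?S" "Q' \<in> ?S" and x: "x \<in> M Q" "x \<in> M Q'" for Q Q' x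
  proof -
    have xP: "x \<in> P Q" "x \<in> P Q'" using x Msub[OF Q(1)] Msub[OF Q(2)] by auto
    have xQ: "x \<in> Q" "x \<in> Q'" using xP Psub[OF Q(1)] Psub[OF Q(2)] by auto
    have s: "s Q = s Q'" using le[OF Q xQ(1) xP(2)] le[OF Q(2,1) xQ(2) xP(1)] by simp
    have PD: "P Q \<in> D" "P Q' \<in> D"
      using lattice_dyadic_gen[OF D S(1)] sel Q unfolding P_def by blast+
    have eqI: "A = B" if AB: "A \<in> D" "B \<in> D" "x \<in> A" "x \<in> B" "A = hcube a l" "B = hcube b l" "0 < l" for A B a b l
    proof -
      have "A \<subseteq> B \<or> B \<subseteq> A"
        using lattice_nested[OF D AB(1-4)] dyadic_gen_subset[OF AB(7)] unfolding AB(5,6) by blast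
      then show ?thesis using hcube_subset_eqI[OF AB(7)] unfolding AB(5,6) by blast
    qed
    have "P Q = P Q'" 
      using eqI[OF PD xP, of "p Q" "s Q" "p Q'"] s sel[OF Q(1)] by (simp add: P_def)
    then have p: "p Q = p Q'" using hcube_eq_iff sel[OF Q(1)] sel[OF Q(2)] unfolding P_def by blast
    have "g Q = g Q'"
    proof -
      define t where "t = s Q / 2 ^ N"
      have t: "0 < t" using sel[OF Q(1)] by (simp add: t_def)
      have "x \<in> hcube (\<chi> i. p Q $ i + real (g Q) * t) t" "x \<in> hcube (\<chi> i. p Q $ i + real (g Q') * t) t"
        using x unfolding M_def s[symmetric] p[symmetric] t_def .
      \<comment> \<open>The cells are shifted equally along all axes, so one coordinate decides;
        \<open>undefined\<close> names it. Intervals of length \<open>t\<close> with offsets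
        \<open>g Q * t\<close> and \<open>g Q' * t\<close> intersect only for equal indices.\<close>
      then have "p Q $ undefined + real (g Q) * t \<le> x $ undefined"
        "x $ undefined < p Q $ undefined + real (g Q) * t + t"
        "p Q $ undefined + real (g Q') * t \<le> x $ undefined"
        "x $ undefined < p Q $ undefined + real (g Q') * t + t"
        unfolding hcube_def by auto
      then have "real (g Q) * t < (real (g Q') + 1) * t" "real (g Q') * t < (real (g Q) + 1) * t"
        unfolding distrib_right mult_1 by linarith+
      then have "real (g Q) < real (g Q') + 1" "real (g Q') < real (g Q) + 1"
        using t mult_less_cancel_right_pos by blast+
      then show ?thesis by linarith
    qed
    \<comment> \<open>Both cubes contain \<open>x\<close> and have side
      \<open>2 ^ g Q * s Q\<close>, so they coincide.\<close>
    then show "Q = Q'" using eqI[OF S(1)[OF Q(1)] S(1)[OF Q(2)] xQ] side[OF Q(1)] side[OF Q(2)] s sel[OF Q(1)]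
      by (metis mult_pos_pos zero_less_numeral zero_less_power)
  qed
  \<comment> \<open>The side of \<open>Q\<close> is \<open>2 ^ g Q * 2 ^ N\<close> times that of
    \<open>M Q\<close>, and \<open>g Q \<le> N\<close>; the summand 1 gives
    \<open>1 < c\<close>.\<close>
  define c where "c = ((2 :: real) ^ N * 2 ^ N) ^ CARD('n) + 1"
  have "1 < c" by (simp add: c_def)
  moreover have "is_cube (M Q)" if "Q \<in> ?S" for Q
    unfolding is_cube_def M_def using sel[OF that] by (metis divide_pos_pos zero_less_numeral zero_less_power)
  moreover have "M Q \<subseteq> Q" if "Q \<in> ?S" for Q using Msub[OF that] Psub[OF that] by blast
  moreover have "M Q \<inter> E = {}" if "Q \<in> ?S" for Q
    using Msub[OF that] sel[OF that] unfolding P_def by blast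
  moreover have "measure lebesgue Q \<le> c * measure lebesgue (M Q)" if Q: "Q \<in> ?S" for Q
  proof -
    have s: "0 < s Q" "g Q \<le> N" using sel[OF Q] by auto
    obtain a where a: "Q = hcube a (2 ^ g Q * s Q)" using side[OF Q] by blast
    have "(2 ^ g Q * s Q) ^ CARD('n) \<le> (2 ^ N * s Q) ^ CARD('n)"
      using s by (intro power_mono mult_right_mono power_increasing) auto
    also have "\<dots> = (2 ^ N * 2 ^ N) ^ CARD('n) * (s Q / 2 ^ N) ^ CARD('n)"
      by (subst power_mult_distrib[symmetric]) simp
    also have "\<dots> \<le> c * (s Q / 2 ^ N) ^ CARD('n)"
      unfolding c_def using s by (intro mult_right_mono) auto
    finally have "(2 ^ g Q * s Q) ^ CARD('n) \<le> c * (s Q / 2 ^ N) ^ CARD('n)" .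
    moreover have "measure lebesgue Q = (2 ^ g Q * s Q) ^ CARD('n)"
      using s by (subst a) (simp add: measure_hcube)
    moreover have "measure lebesgue (M Q) = (s Q / 2 ^ N) ^ CARD('n)"
      unfolding M_def using s by (simp add: measure_hcube)
    ultimately show ?thesis by simp
  qed
  moreover have "?S \<subseteq> D" using S(1) by blast
  moreover have "M Q \<inter> M Q' = {}" if "Q \<in> ?S" "Q' \<in> ?S" "Q \<noteq> Q'" for Q Q'
    using disj[OF that(1,2)] that(3) by blast
  ultimately show ?thesis
    unfolding well_sparse_def by (intro conjI exI[of _ c] exI[of _ M] ballI impI) auto
qed

subsection \<open>Distance weights\<close>

lemma linf_dist_singleton: "linf_dist {x} E = (INF y\<in>E. infnorm (x - y))"
proof -
  have "(\<lambda>(x, y). infnorm (x - y)) ` ({x} \<times> E) = (\<lambda>y. infnorm (x - y)) ` E" by force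
  then show ?thesis unfolding linf_dist_def by simp
qed

lemma bdd_below_infnorm_image: "bdd_below ((\<lambda>y. infnorm (f y)) ` E)"
  by (intro bdd_belowI2[of _ 0]) (simp add: infnorm_pos_le)

lemma linf_dist_le: "y \<in> E \<Longrightarrow> linf_dist {x} E \<le> infnorm (x - y)"
  unfolding linf_dist_singleton by (intro cINF_lower bdd_below_infnorm_image)

lemma linf_dist_nonneg: "E \<noteq> {} \<Longrightarrow> 0 \<le> linf_dist {x} E"
  unfolding linf_dist_singleton by (intro cINF_greatest) (auto simp: infnorm_pos_le)

lemma linf_dist_lessD:
  assumes "E \<noteq> {}" "linf_dist {x} E < r"
  obtains y where "y \<in> E" "infnorm (x - y) < r"
  using assms cInf_lessD[of "(\<lambda>y. infnorm (x - y)) ` E" r] unfolding linf_dist_singleton by blast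

text \<open>The displacement is measured in the Euclidean \<open>norm\<close>, which dominates
  \<open>infnorm\<close>, so that the distance is Lipschitz for the metric of the type and hence
  measurable.\<close>

lemma linf_dist_triangle:
  assumes "E \<noteq> {}"
  shows "linf_dist {x} E \<le> linf_dist {x'} E + norm (x - x')"
proof -
  have "linf_dist {x} E - norm (x - x') \<le> infnorm (x' - y)" if y: "y \<in> E" for y
    using linf_dist_le[OF y, of x] infnorm_triangle[of "x - x'" "x' - y"] infnorm_le_norm[of "x - x'"]
    by simp
  then have "linf_dist {x} E - norm (x - x') \<le> linf_dist {x'} E"
    unfolding linf_dist_singleton[of x'] by (intro cINF_greatest assms)
  then show ?thesis by simp
qed

lemma continuous_on_linf_dist:
  fixes E :: "(real ^ 'n) set"
  assumes "E \<noteq> {}"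
  shows "continuous_on A (\<lambda>x. linf_dist {x} E)"
proof -
  have "1-lipschitz_on A (\<lambda>x. linf_dist {x} E)"
  proof (rule lipschitz_onI)
    fix x y
    show "dist (linf_dist {x} E) (linf_dist {y} E) \<le> 1 * dist x y"
      using linf_dist_triangle[OF assms, of x y] linf_dist_triangle[OF assms, of y x]
      by (simp add: dist_norm norm_minus_commute)
  qed simp
  then show ?thesis by (rule lipschitz_on_continuous_on)
qed

lemma borel_measurable_linf_dist:
  fixes E :: "(real ^ 'n) set"
  assumes "E \<noteq> {}"
  shows "(\<lambda>x. linf_dist {x} E) \<in> borel_measurable lebesgue"
  using borel_measurable_continuous_onI[OF continuous_on_linf_dist[OF assms]]
  by (simp add: measurable_completion)

lemma borel_measurable_weight:
  fixes E :: "(real ^ 'n) set"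
  assumes "E \<noteq> {}"
  shows "(\<lambda>x. inverse (ennreal (linf_dist {x} E powr \<alpha>))) \<in> borel_measurable lebesgue"
  using borel_measurable_linf_dist[OF assms] by measurable

lemma borel_measurable_weight_indicator:
  fixes E :: "(real ^ 'n) set"
  assumes "E \<noteq> {}" "A \<in> sets lebesgue"
  shows "(\<lambda>x. inverse (ennreal (linf_dist {x} E powr \<alpha>)) * indicator A x) \<in> borel_measurable lebesgue"
  using assms by (intro borel_measurable_times_ennreal borel_measurable_weight borel_measurable_indicator)

lemma linf_dist_closure:
  assumes E: "E \<noteq> {}" and x: "x \<in> closure E"
  shows "linf_dist {x} E = 0"
proof -
  have "linf_dist {x} E < e" if "0 < e" for e
  proof -
    obtain y where y: "y \<in> E" "dist y x < e" using x \<open>0 < e\<close> unfolding closure_approachable by blast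
    then show ?thesis
      using linf_dist_le[OF y(1), of x] infnorm_le_norm[of "x - y"] by (simp add: dist_norm norm_minus_commute)
  qed
  then have "linf_dist {x} E \<le> 0" by (meson less_irrefl not_le)
  then show ?thesis using linf_dist_nonneg[OF E, of x] by simp
qed

section \<open>Lower bound, positivity and additivity of the weights\<close>

lemma infnorm_le_cart:
  fixes x :: "real ^ 'n"
  assumes "\<And>i. \<bar>x $ i\<bar> \<le> r"
  shows "infnorm x \<le> r"
  unfolding infnorm_cart using assms by (intro cSup_least) auto

text \<open>At \<open>d = 0\<close> the right-hand side is infinite, since
  \<open>0 powr \<alpha> = 0\<close>.\<close>

lemma weight_ge:
  assumes "0 < r" "0 \<le> \<alpha>" "0 \<le> d" "d \<le> r"
  shows "ennreal (r powr - \<alpha>) \<le> inverse (ennreal (d powr \<alpha>))"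
proof (cases "d = 0")
  case False
  then have d: "0 < d powr \<alpha>" using assms by simp
  have "r powr - \<alpha> \<le> d powr - \<alpha>" using assms False by (intro powr_mono2') auto
  then show ?thesis using inverse_ennreal[OF d] by (simp add: powr_minus ennreal_leI)
qed simp

lemma weight_le:
  assumes "0 < r" "0 \<le> \<alpha>" "r \<le> d"
  shows "inverse (ennreal (d powr \<alpha>)) \<le> ennreal (r powr - \<alpha>)"
proof -
  have d: "0 < d powr \<alpha>" using assms by simp
  have "d powr - \<alpha> \<le> r powr - \<alpha>" using assms by (intro powr_mono2') auto
  then show ?thesis using inverse_ennreal[OF d] by (simp add: powr_minus ennreal_leI)
qed

text \<open>Any two points of the cube differ by at most \<open>l\<close> in \<open>infnorm\<close>,
  so the integrand is at least \<open>l powr - \<alpha>\<close> throughout.\<close>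

lemma dist_weight_ge:
  fixes E :: "(real ^ 'n) set"
  assumes l: "0 < l" and \<alpha>: "0 \<le> \<alpha>" and meets: "hcube a l \<inter> E \<noteq> {}"
  shows "ennreal (l powr (real CARD('n) - \<alpha>)) \<le> dist_weight \<alpha> E (hcube a l)"
proof -
  have E: "E \<noteq> {}" using meets by blast
  have "l powr (real CARD('n) - \<alpha>) = l powr - \<alpha> * l ^ CARD('n)"
    using l by (simp add: powr_realpow[symmetric] powr_add[symmetric])
  then have "ennreal (l powr (real CARD('n) - \<alpha>)) = ennreal (l powr - \<alpha>) * emeasure lebesgue (hcube a l)"
    unfolding emeasure_hcube[OF l] using l by (simp add: ennreal_mult)
  also have "\<dots> = (\<integral>\<^sup>+ x. ennreal (l powr - \<alpha>) * indicator (hcube a l) x \<partial>lebesgue)"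
    by (intro nn_integral_cmult_indicator[symmetric] hcube_lebesgue)
  also have "\<dots> \<le> dist_weight \<alpha> E (hcube a l)"
    unfolding dist_weight_def
  proof (rule nn_integral_mono)
    fix x
    show "ennreal (l powr - \<alpha>) * indicator (hcube a l) x
      \<le> inverse (ennreal (linf_dist {x} E powr \<alpha>)) * indicator (hcube a l) x"
    proof (cases "x \<in> hcube a l")
      case True
      obtain y where y: "y \<in> hcube a l" "y \<in> E" using meets by blast
      have "infnorm (x - y) \<le> l"
      proof (rule infnorm_le_cart)
        fix i
        have "a $ i \<le> x $ i" "x $ i < a $ i + l" "a $ i \<le> y $ i" "y $ i < a $ i + l"
          using True y(1) by (auto simp: hcube_def)
        then show "\<bar>(x - y) $ i\<bar> \<le> l" by simp
      qed
      then have "linf_dist {x} E \<le> l" using linf_dist_le[OF y(2), of x] by simp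
      then show ?thesis using weight_ge[OF l \<alpha> linf_dist_nonneg[OF E]] True by simp
    qed simp
  qed
  finally show ?thesis .
qed

text \<open>The integrand is the inverse of a finite value, so it vanishes nowhere, and the cube has
  positive measure. Positivity permits cancelling the weight later.\<close>

lemma dist_weight_pos:
  fixes E :: "(real ^ 'n) set"
  assumes E: "E \<noteq> {}" and l: "0 < l"
  shows "dist_weight \<alpha> E (hcube a l) \<noteq> 0"
proof
  let ?f = "\<lambda>x. inverse (ennreal (linf_dist {x} E powr \<alpha>)) * indicator (hcube a l) x"
  have "?f \<in> borel_measurable lebesgue"
    by (intro borel_measurable_weight_indicator E hcube_lebesgue)
  moreover assume "dist_weight \<alpha> E (hcube a l) = 0"
  ultimately have "AE x in lebesgue. ?f x = 0"
    unfolding dist_weight_def using nn_integral_0_iff_AE by blast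
  then have "AE x in lebesgue. x \<notin> hcube a l"
    by (rule AE_mp) (auto split: split_indicator)
  then have "emeasure lebesgue (hcube a l) = 0"
    using AE_iff_measurable[OF hcube_lebesgue[of a l], of "\<lambda>x. x \<notin> hcube a l"] by simp
  then show False unfolding emeasure_hcube[OF l] using zero_less_power[OF l, of "CARD('n)"] by (simp add: ennreal_eq_0_iff not_le)
qed

text \<open>The indicators of the disjoint pieces add up to the indicator of the cube.\<close>

lemma dist_weight_gen:
  fixes E :: "(real ^ 'n) set"
  assumes E: "E \<noteq> {}" and l: "0 < l"
  shows "(\<Sum>Q\<in>dyadic_gen j (hcube a l). dist_weight \<alpha> E Q) = dist_weight \<alpha> E (hcube a l)"
proof -
  let ?G = "dyadic_gen j (hcube a l)"
  let ?f = "\<lambda>x. inverse (ennreal (linf_dist {x} E powr \<alpha>))"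
  have "(\<Sum>Q\<in>?G. dist_weight \<alpha> E Q) = (\<integral>\<^sup>+ x. (\<Sum>Q\<in>?G. ?f x * indicator Q x) \<partial>lebesgue)"
    unfolding dist_weight_def
  proof (rule nn_integral_sum[symmetric])
    fix Q assume "Q \<in> ?G"
    then obtain q where "Q = hcube q (l / 2 ^ j)" using dyadic_gen_shape[OF l] by blast
    then show "(\<lambda>x. ?f x * indicator Q x) \<in> borel_measurable lebesgue"
      by (simp only: borel_measurable_weight_indicator[OF E hcube_lebesgue])
  qed
  also have "\<dots> = (\<integral>\<^sup>+ x. ?f x * indicator (hcube a l) x \<partial>lebesgue)"
  proof (intro nn_integral_cong)
    fix x
    have "disjoint_family_on (\<lambda>Q. Q) ?G"
      using dyadic_gen_tiling(2)[OF l, of j a] unfolding disjoint_def disjoint_family_on_def by blast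
    then have "indicator (\<Union>Q\<in>?G. Q) x = (\<Sum>Q\<in>?G. indicator Q x :: ennreal)"
      using finite_dyadic_gen[OF l] by (intro indicator_UN_disjoint)
    then show "(\<Sum>Q\<in>?G. ?f x * indicator Q x) = ?f x * indicator (hcube a l) x"
      using dyadic_gen_tiling(3)[OF l, of j a] by (simp add: sum_distrib_left[symmetric])
  qed
  finally show ?thesis unfolding dist_weight_def .
qed

text \<open>Without a free cube up to generation \<open>N\<close>, each of the \<open>N + 1\<close>
  generations contributes the full weight of \<open>R\<close>. This weight is positive and finite,
  so it cancels and contradicts \<open>\<xi> < N\<close>.\<close>

lemma weight_condition_imp_porous:
  fixes E :: "(real ^ 'n) set"
  assumes D: "dyadic_lattice D" and E: "E \<noteq> {}"
    and fin: "\<And>R. R \<in> D \<Longrightarrow> dist_weight \<alpha> E R < \<infinity>"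
    and sum: "\<And>R. R \<in> D \<Longrightarrow>
      (\<Sum>\<^sub>\<infinity>Q\<in>dyadic_meeting E R. dist_weight \<alpha> E Q) \<le> ennreal \<xi> * dist_weight \<alpha> E R"
  shows "porous D E"
proof -
  obtain N :: nat where N: "\<xi> < real N" using reals_Archimedean2 by blast
  have "\<exists>j\<le>N. \<exists>Q\<in>dyadic_gen j R. Q \<inter> E = {}" if R: "R \<in> D" for R
  proof (rule ccontr)
    assume no: "\<not> ?thesis"
    obtain a l where l: "0 < l" and Ra: "R = hcube a l" using lattice_cube[OF D R] .
    let ?w = "dist_weight \<alpha> E R"
    \<comment> \<open>Cubes of different generations have different sides, so no cube is counted
      twice and the union carries the full multiple of \<open>?w\<close>.\<close>
    have disj: "dyadic_gen i R \<inter> dyadic_gen j R = {}" if "i \<noteq> j" for i j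
    proof (rule ccontr)
      assume "dyadic_gen i R \<inter> dyadic_gen j R \<noteq> {}"
      then obtain Q where Q: "Q \<in> dyadic_gen i (hcube a l)" "Q \<in> dyadic_gen j (hcube a l)" using Ra by blast
      obtain b b' where "Q = hcube b (l / 2 ^ i)" "Q = hcube b' (l / 2 ^ j)"
        using dyadic_gen_shape[OF l Q(1)] dyadic_gen_shape[OF l Q(2)] by blast
      then have "l / 2 ^ i = l / 2 ^ j" using hcube_eq_iff[of "l / 2 ^ i" "l / 2 ^ j" b b'] l by simp
      then show False using l that by simp
    qed
    have "ennreal (real (Suc N)) * ?w = (\<Sum>j\<le>N. ?w)" by (simp add: ennreal_of_nat_eq_real_of_nat del: of_nat_Suc)
    also have "\<dots> = (\<Sum>j\<le>N. \<Sum>Q\<in>dyadic_gen j R. dist_weight \<alpha> E Q)"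
      unfolding Ra dist_weight_gen[OF E l] ..
    also have "\<dots> = (\<Sum>Q\<in>(\<Union>j\<le>N. dyadic_gen j R). dist_weight \<alpha> E Q)"
      using disj finite_dyadic_gen[OF l] Ra by (intro sum.UNION_disjoint[symmetric]) auto
    also have "\<dots> \<le> (\<Sum>\<^sub>\<infinity>Q\<in>dyadic_meeting E R. dist_weight \<alpha> E Q)"
    proof (rule sum_le_infsum_ennreal)
      show "finite (\<Union>j\<le>N. dyadic_gen j R)" unfolding Ra by (intro finite_UN_I finite_atMost finite_dyadic_gen[OF l])
      show "(\<Union>j\<le>N. dyadic_gen j R) \<subseteq> dyadic_meeting E R"
        using no unfolding dyadic_meeting_def dyadic_def by blast
    qed
    also have "\<dots> \<le> ennreal \<xi> * ?w" by (rule sum[OF R])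
    finally have "?w * ennreal (real (Suc N)) \<le> ?w * ennreal \<xi>" by (simp add: mult.commute)
    moreover have "?w \<noteq> 0" "?w \<noteq> top" using dist_weight_pos[OF E l] fin[OF R] Ra by auto
    ultimately have "ennreal (real (Suc N)) \<le> ennreal \<xi>" by (simp add: ennreal_mult_le_mult_iff)
    moreover have "ennreal \<xi> < ennreal (real (Suc N))" using N by (intro ennreal_lessI) auto
    ultimately show False by simp
  qed
  then show ?thesis by (intro porousI_gen[OF D E, of N])
qed

text \<open>The points of \<open>E\<close> near \<open>x\<close> may lie outside the cube of \<open>x\<close>, so they are counted in the tripled cube.\<close>

lemma emeasure_near_le:
  fixes E :: "(real ^ 'n) set"
  assumes E: "E \<noteq> {}" and bd: "meeting_bound E C \<gamma>" and l: "0 < l"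
  shows "emeasure lebesgue {x \<in> hcube a l. linf_dist {x} E < l / 2 ^ j}
    \<le> ennreal (C * 9 ^ CARD('n) * l ^ CARD('n) * \<gamma> ^ j)"
proof -
  \<comment> \<open>\<open>s\<close> is the side of generation \<open>j\<close> of the tripled cube
    \<open>T\<close>. As \<open>s\<close> is at least \<open>l / 2 ^ j\<close>, tripling a cube
    \<open>Q\<close> that contains a point \<open>y\<close> of \<open>E\<close> captures all points
    \<open>x\<close> near \<open>y\<close>. The two triplings produce the constant 9.\<close>
  define s where "s = 3 * l / 2 ^ j"
  have s: "0 < s" "l / 2 ^ j \<le> s" using l by (auto simp: s_def divide_right_mono)
  then have s3: "0 < 3 * s" by simp
  define T where "T = hcube (\<chi> i. a $ i - l) (3 * l)"
  have l3: "0 < 3 * l" using l by simp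
  have fin: "finite (meeting_gen E j T)" unfolding T_def by (rule finite_meeting_gen[OF l3])
  have "\<forall>Q\<in>meeting_gen E j T. \<exists>b. Q = hcube b s"
    using meeting_gen_shape[OF l3] unfolding T_def s_def by blast
  then obtain b where b: "\<forall>Q\<in>meeting_gen E j T. Q = hcube (b Q) s" unfolding bchoice_iff ..
  define V where "V = (\<lambda>Q. hcube (\<chi> i. b Q $ i - s) (3 * s))"
  have "{x \<in> hcube a l. linf_dist {x} E < l / 2 ^ j} \<subseteq> (\<Union>Q\<in>meeting_gen E j T. V Q)"
  proof
    fix x assume "x \<in> {x \<in> hcube a l. linf_dist {x} E < l / 2 ^ j}"
    then have x: "\<And>i. a $ i \<le> x $ i" "\<And>i. x $ i < a $ i + l" and near: "linf_dist {x} E < l / 2 ^ j"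
      by (auto simp: hcube_def)
    obtain y where y: "y \<in> E" "infnorm (x - y) < l / 2 ^ j" using linf_dist_lessD[OF E near] .
    have xy: "\<bar>x $ i - y $ i\<bar> < l / 2 ^ j" for i
      using component_le_infnorm_cart[of "x - y" i] y(2) by simp
    have "l / 2 ^ j \<le> l" using l by (simp add: field_simps)
    then have "a $ i - l \<le> y $ i \<and> y $ i < a $ i - l + 3 * l" for i
      using xy[of i] x[of i] by linarith
    then have "y \<in> T" unfolding T_def hcube_def by simp
    then obtain Q where Q: "Q \<in> dyadic_gen j T" "y \<in> Q"
      unfolding T_def using dyadic_gen_cover[OF l3] by blast
    then have QM: "Q \<in> meeting_gen E j T" using y(1) unfolding meeting_gen_def by blast
    then have "y \<in> hcube (b Q) s" using b Q(2) by blast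
    then have yb: "\<And>i. b Q $ i \<le> y $ i" "\<And>i. y $ i < b Q $ i + s" by (auto simp: hcube_def)
    have "b Q $ i - s \<le> x $ i \<and> x $ i < b Q $ i - s + 3 * s" for i
      using xy[of i] yb[of i] s(2) by linarith
    then have "x \<in> V Q" unfolding V_def hcube_def by simp
    then show "x \<in> (\<Union>Q\<in>meeting_gen E j T. V Q)" using QM by blast
  qed
  then have "emeasure lebesgue {x \<in> hcube a l. linf_dist {x} E < l / 2 ^ j}
      \<le> emeasure lebesgue (\<Union>Q\<in>meeting_gen E j T. V Q)"
    using fin unfolding V_def by (intro emeasure_mono sets.finite_UN hcube_lebesgue)
  also have "\<dots> \<le> (\<Sum>Q\<in>meeting_gen E j T. emeasure lebesgue (V Q))"
    using fin unfolding V_def by (intro emeasure_subadditive_finite) (auto simp: hcube_lebesgue)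
  also have "\<dots> = ennreal (card (meeting_gen E j T) * (3 * s) ^ CARD('n))"
    using s3 unfolding V_def emeasure_hcube[OF s3]
    by (simp add: ennreal_mult' ennreal_of_nat_eq_real_of_nat del: power_mult_distrib)
  also have "\<dots> \<le> ennreal ((C * \<gamma> ^ j * (2 ^ j) ^ CARD('n)) * (3 * s) ^ CARD('n))"
    using bd l3 s(1) unfolding meeting_bound_def T_def by (intro ennreal_leI mult_right_mono) auto
  also have "(C * \<gamma> ^ j * (2 ^ j) ^ CARD('n)) * (3 * s) ^ CARD('n) = C * \<gamma> ^ j * (2 ^ j * (3 * s)) ^ CARD('n)"
    by (simp only: power_mult_distrib ac_simps)
  also have "2 ^ j * (3 * s) = 9 * l" by (simp add: s_def)
  also have "C * \<gamma> ^ j * (9 * l) ^ CARD('n) = C * 9 ^ CARD('n) * l ^ CARD('n) * \<gamma> ^ j"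
    by (simp only: power_mult_distrib ac_simps)
  finally show ?thesis .
qed

text \<open>\<open>Suc j\<close> is the first generation with side at most \<open>\<delta>\<close>;
  it is not 0 because \<open>\<delta> < l\<close>.\<close>

lemma dyadic_scale:
  assumes "0 < \<delta>" "\<delta> < (l :: real)"
  obtains j where "l / 2 ^ Suc j \<le> \<delta>" "\<delta> < l / 2 ^ j"
proof -
  let ?P = "\<lambda>j. l / 2 ^ j \<le> \<delta>"
  obtain j0 where "l / \<delta> < 2 ^ j0" using real_arch_pow[of 2 "l / \<delta>"] by auto
  then have "?P j0" using assms(1) by (simp add: field_simps)
  then have P: "?P (Least ?P)" by (rule LeastI)
  then have "Least ?P \<noteq> 0" using assms by (intro notI) simp
  then obtain j where j: "Least ?P = Suc j" using not0_implies_Suc by blast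
  then have "\<not> ?P j" by (intro not_less_Least) simp
  then show thesis using that P unfolding j by force
qed

text \<open>The layers \<open>l / 2 ^ Suc j \<le> dist < l / 2 ^ j\<close> contribute at most
  \<open>(2 ^ Suc j / l) powr \<alpha>\<close> each; as the sum diverges at distance \<open>0\<close>, the bound holds there too.\<close>

lemma weight_le_layers:
  assumes l: "0 < l" and \<alpha>: "0 < \<alpha>" and \<delta>: "0 \<le> \<delta>"
  shows "inverse (ennreal (\<delta> powr \<alpha>)) \<le>
    ennreal (l powr - \<alpha>) * (1 + (\<Sum>j. ennreal ((2 powr \<alpha>) ^ Suc j) * (if \<delta> < l / 2 ^ j then 1 else 0)))"
    (is "_ \<le> ?c * (1 + (\<Sum>j. ?t j))")
proof -
  consider "\<delta> = 0" | "0 < \<delta>" "\<delta> < l" | "l \<le> \<delta>" using \<delta> by linarith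
  then show ?thesis
  proof cases
    case 1
    have le: "of_nat n \<le> (\<Sum>j. ?t j)" for n
    proof -
      have "1 \<le> ?t j" for j
        using 1 l \<alpha> one_le_power[OF ge_one_powr_ge_zero, of 2 \<alpha> "Suc j"] by (simp add: ennreal_ge_1 del: power_Suc)
      then have "(\<Sum>j<n. 1) \<le> (\<Sum>j<n. ?t j)" by (intro sum_mono)
      also have "\<dots> \<le> (\<Sum>j. ?t j)" by (intro sum_le_suminf summableI) auto
      finally show ?thesis by simp
    qed
    have "(\<Sum>j. ?t j) = top"
    proof (rule ccontr)
      assume "(\<Sum>j. ?t j) \<noteq> top"
      then obtain n where "(\<Sum>j. ?t j) < of_nat n"
        using ennreal_Ex_less_of_nat unfolding less_top by blast
      then show False using le[of n] by (simp only: not_le[symmetric])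
    qed
    then show ?thesis using l by (simp add: ennreal_mult_top)
  next
    \<comment> \<open>The single term of the layer containing \<open>\<delta>\<close> already
      dominates.\<close>
    case 2
    obtain j where j: "l / 2 ^ Suc j \<le> \<delta>" "\<delta> < l / 2 ^ j" using dyadic_scale[OF 2] .
    have "(2 ^ Suc j) powr \<alpha> = (2 powr \<alpha>) ^ Suc j"
      by (simp add: powr_realpow[symmetric] powr_powr mult.commute del: power_Suc)
    then have "(l / 2 ^ Suc j) powr - \<alpha> = l powr - \<alpha> * (2 powr \<alpha>) ^ Suc j"
      using l by (simp add: powr_divide powr_minus field_simps del: power_Suc)
    then have "inverse (ennreal (\<delta> powr \<alpha>)) \<le> ?c * ennreal ((2 powr \<alpha>) ^ Suc j)"
      using weight_le[of "l / 2 ^ Suc j" \<alpha> \<delta>] l \<alpha> j(1) by (simp add: ennreal_mult del: power_Suc)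
    also have "\<dots> \<le> ?c * (1 + (\<Sum>j. ?t j))"
    proof (rule mult_left_mono)
      have "ennreal ((2 powr \<alpha>) ^ Suc j) = (\<Sum>i\<in>{j}. ?t i)" using j(2) by simp
      also have "\<dots> \<le> (\<Sum>j. ?t j)" by (intro sum_le_suminf summableI) auto
      finally show "ennreal ((2 powr \<alpha>) ^ Suc j) \<le> 1 + (\<Sum>j. ?t j)" by (rule order_trans) simp
    qed simp
    finally show ?thesis .
  next
    \<comment> \<open>No layer contains a distance of at least \<open>l\<close>; the summand 1
      accounts for it.\<close>
    case 3
    have "inverse (ennreal (\<delta> powr \<alpha>)) \<le> ?c * 1" using weight_le[OF l _ 3] \<alpha> by simp
    also have "\<dots> \<le> ?c * (1 + (\<Sum>j. ?t j))" by (intro mult_left_mono) auto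
    finally show ?thesis .
  qed
qed

text \<open>Integrating the layer bound termwise, \<open>emeasure_near_le\<close> leaves a geometric
  series of ratio \<open>2 powr \<alpha> * \<gamma>\<close>. The summand 1 stems from the cube
  itself, the factor \<open>2 powr \<alpha>\<close> from the shift in \<open>Suc j\<close>.\<close>

lemma dist_weight_le:
  fixes E :: "(real ^ 'n) set"
  assumes E: "E \<noteq> {}" and bd: "meeting_bound E C \<gamma>" and \<alpha>: "0 < \<alpha>" and r: "2 powr \<alpha> * \<gamma> < 1"
    and l: "0 < l"
  shows "dist_weight \<alpha> E (hcube a l) \<le>
    ennreal ((1 + 2 powr \<alpha> * C * 9 ^ CARD('n) / (1 - 2 powr \<alpha> * \<gamma>)) * l powr (real CARD('n) - \<alpha>))"
proof -
  let ?R = "hcube a l" and ?r = "2 powr \<alpha> * \<gamma>" and ?b = "\<lambda>j. (2 powr \<alpha>) ^ Suc j"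
  have C: "0 < C" "0 < \<gamma>" using bd by (auto simp: meeting_bound_def)
  define c where "c = l powr - \<alpha>"
  define A where "A = (\<lambda>j :: nat. {x \<in> ?R. linf_dist {x} E < l / 2 ^ j})"
  have A: "A j \<in> sets lebesgue" for j
  proof -
    have "A j = ?R \<inter> {x \<in> space lebesgue. linf_dist {x} E < l / 2 ^ j}" by (auto simp: A_def)
    also have "\<dots> \<in> sets lebesgue"
      using borel_measurable_linf_dist[OF E] by (intro sets.Int hcube_lebesgue) measurable
    finally show ?thesis .
  qed
  have "dist_weight \<alpha> E ?R \<le> (\<integral>\<^sup>+ x. ennreal c * (indicator ?R x + (\<Sum>j. ennreal (?b j) * indicator (A j) x)) \<partial>lebesgue)"
    unfolding dist_weight_def
  proof (intro nn_integral_mono)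
    fix x
    show "inverse (ennreal (linf_dist {x} E powr \<alpha>)) * indicator ?R x
      \<le> ennreal c * (indicator ?R x + (\<Sum>j. ennreal (?b j) * indicator (A j) x))"
    proof (cases "x \<in> ?R")
      case True
      then have "(if linf_dist {x} E < l / 2 ^ j then 1 else 0) = (indicator (A j) x :: ennreal)" for j
        by (simp add: A_def)
      then show ?thesis using True weight_le_layers[OF l \<alpha> linf_dist_nonneg[OF E], of x]
        by (simp add: c_def del: power_Suc)
    qed simp
  qed
  also have "\<dots> = ennreal c * (emeasure lebesgue ?R + (\<Sum>j. ennreal (?b j) * emeasure lebesgue (A j)))"
  proof -
    have m: "(\<lambda>x. ennreal (?b j) * indicator (A j) x) \<in> borel_measurable lebesgue" for j
      by (intro borel_measurable_times_ennreal borel_measurable_const borel_measurable_indicator A)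
    have "(\<integral>\<^sup>+ x. (\<Sum>j. ennreal (?b j) * indicator (A j) x) \<partial>lebesgue) = (\<Sum>j. ennreal (?b j) * emeasure lebesgue (A j))"
      by (subst nn_integral_suminf[OF m]) (simp only: nn_integral_cmult_indicator[OF A])
    moreover have mS: "(\<lambda>x. \<Sum>j. ennreal (?b j) * indicator (A j) x) \<in> borel_measurable lebesgue"
      using m by (intro borel_measurable_suminf_order)
    moreover have mR: "(indicator ?R :: _ \<Rightarrow> ennreal) \<in> borel_measurable lebesgue"
      by (intro borel_measurable_indicator hcube_lebesgue)
    ultimately show ?thesis
      by (simp only: nn_integral_cmult[OF borel_measurable_add[OF mR mS]] nn_integral_add[OF mR mS]
          nn_integral_indicator[OF hcube_lebesgue])
  qed
  also have "\<dots> \<le> ennreal c * (ennreal (l ^ CARD('n)) + ennreal (2 powr \<alpha> * C * 9 ^ CARD('n) * l ^ CARD('n) / (1 - ?r)))"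
  proof (intro mult_left_mono add_mono)
    show "emeasure lebesgue ?R \<le> ennreal (l ^ CARD('n))" by (simp only: emeasure_hcube[OF l] order_refl)
    let ?u = "\<lambda>j. 2 powr \<alpha> * C * 9 ^ CARD('n) * l ^ CARD('n) * ?r ^ j"
    have "(\<Sum>j. ennreal (?b j) * emeasure lebesgue (A j)) \<le> (\<Sum>j. ennreal (?u j))"
    proof (intro suminf_le summableI)
      fix j
      have "ennreal (?b j) * emeasure lebesgue (A j)
          \<le> ennreal (?b j) * ennreal (C * 9 ^ CARD('n) * l ^ CARD('n) * \<gamma> ^ j)"
        unfolding A_def by (intro mult_left_mono emeasure_near_le[OF E bd l]) simp
      also have "\<dots> = ennreal (?b j * (C * 9 ^ CARD('n) * l ^ CARD('n) * \<gamma> ^ j))"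
        by (intro ennreal_mult'[symmetric]) simp
      also have "?b j * (C * 9 ^ CARD('n) * l ^ CARD('n) * \<gamma> ^ j) = ?u j"
        by (simp only: power_Suc power_mult_distrib ac_simps)
      finally show "ennreal (?b j) * emeasure lebesgue (A j) \<le> ennreal (?u j)" .
    qed
    also have "\<dots> = ennreal (2 powr \<alpha> * C * 9 ^ CARD('n) * l ^ CARD('n) * (1 / (1 - ?r)))"
      using C l r by (intro suminf_ennreal_eq sums_mult geometric_sums) auto
    finally show "(\<Sum>j. ennreal (?b j) * emeasure lebesgue (A j))
        \<le> ennreal (2 powr \<alpha> * C * 9 ^ CARD('n) * l ^ CARD('n) / (1 - ?r))" by simp
  qed simp_all
  also have "\<dots> = ennreal (c * (l ^ CARD('n) + 2 powr \<alpha> * C * 9 ^ CARD('n) * l ^ CARD('n) / (1 - ?r)))"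
    using C l r by (simp add: c_def ennreal_mult ennreal_plus)
  also have "c * (l ^ CARD('n) + 2 powr \<alpha> * C * 9 ^ CARD('n) * l ^ CARD('n) / (1 - ?r)) =
      (1 + 2 powr \<alpha> * C * 9 ^ CARD('n) / (1 - ?r)) * (l ^ CARD('n) * c)"
    by (simp add: distrib_left distrib_right)
  also have "l ^ CARD('n) * c = l powr (real CARD('n) - \<alpha>)"
    using l by (simp add: c_def powr_realpow[symmetric] powr_add[symmetric])
  finally show ?thesis .
qed

text \<open>The integrand is infinite on \<open>closure E\<close>, so a finite integral over
  \<open>R\<close> makes \<open>closure E \<inter> R\<close> null. Countably many lattice cubes,
  containing the balls of integer radius, exhaust the space.\<close>

lemma closure_null:
  fixes E :: "(real ^ 'n) set"
  assumes D: "dyadic_lattice D" and E: "E \<noteq> {}" and fin: "\<And>R. R \<in> D \<Longrightarrow> dist_weight \<alpha> E R < \<infinity>"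
  shows "emeasure lebesgue (closure E) = 0"
proof -
  have cl: "closure E \<inter> R \<in> null_sets lebesgue" if R: "R \<in> D" for R
  proof -
    let ?f = "\<lambda>x. inverse (ennreal (linf_dist {x} E powr \<alpha>)) * indicator R x"
    obtain a l where Ra: "R = hcube a l" using lattice_cube[OF D R] .
    have "?f \<in> borel_measurable lebesgue" unfolding Ra
      by (intro borel_measurable_weight_indicator E hcube_lebesgue)
    moreover have "integral\<^sup>N lebesgue ?f \<noteq> \<infinity>" using fin[OF R] unfolding dist_weight_def by simp
    ultimately have "AE x in lebesgue. ?f x \<noteq> \<infinity>" by (rule nn_integral_PInf_AE)
    then have ae: "AE x in lebesgue. x \<notin> closure E \<inter> R"
      by (rule AE_mp) (auto simp: linf_dist_closure[OF E])
    have S: "closure E \<inter> R \<in> sets lebesgue"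
      unfolding Ra by (intro sets.Int hcube_lebesgue) simp
    have "(AE x in lebesgue. x \<notin> closure E \<inter> R) \<longleftrightarrow> emeasure lebesgue (closure E \<inter> R) = 0"
      by (rule AE_iff_measurable[OF S]) auto
    then show ?thesis using ae S by (intro null_setsI) blast+
  qed
  have "\<forall>n. \<exists>R\<in>D. cball 0 (real n) \<subseteq> R"
    using D unfolding dyadic_lattice_def by (simp add: compact_cball)
  then obtain R where R: "\<And>n. R n \<in> D" "\<And>n. cball 0 (real n) \<subseteq> R n" by metis
  have "closure E = (\<Union>n. closure E \<inter> R n)"
  proof (intro set_eqI iffI)
    fix x assume "x \<in> closure E"
    moreover obtain n where "norm x \<le> real n" using real_arch_simple by blast
    then have "x \<in> R n" using R(2)[of n] by auto
    ultimately show "x \<in> (\<Union>n. closure E \<inter> R n)" by blast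
  qed blast
  moreover have "(\<Union>n. closure E \<inter> R n) \<in> null_sets lebesgue"
    using cl R(1) by (intro null_sets_UN) blast
  ultimately show ?thesis by auto
qed

lemma meeting_bound_exponent:
  assumes "meeting_bound E C \<gamma>"
  obtains \<alpha> where "0 < \<alpha>" "2 powr \<alpha> * \<gamma> < 1"
proof
  have \<gamma>: "0 < \<gamma>" "\<gamma> < 1" using assms by (auto simp: meeting_bound_def)
  \<comment> \<open>With this exponent \<open>2 powr \<alpha>\<close> is
    \<open>\<gamma> powr (- 1 / 2)\<close>, so the product is the square root of
    \<open>\<gamma>\<close>.\<close>
  show "0 < - log 2 \<gamma> / 2" using \<gamma> by simp
  have "2 powr (- log 2 \<gamma> / 2) * \<gamma> = 2 powr (- log 2 \<gamma> / 2) * 2 powr log 2 \<gamma>" using \<gamma> by simp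
  also have "\<dots> = 2 powr (log 2 \<gamma> / 2)" by (simp add: powr_add[symmetric])
  also have "\<dots> < 1" using \<gamma> powr_less_mono[of "log 2 \<gamma> / 2" 0 "2 :: real"] by simp
  finally show "2 powr (- log 2 \<gamma> / 2) * \<gamma> < 1" .
qed

theorem theorem1:
  fixes E :: "(real ^ 'n) set" and D :: "(real ^ 'n) set set"
  assumes "E \<noteq> {}" and "dyadic_lattice D"
  shows "(porous D E \<longleftrightarrow> well_sparse D (lattice_meeting D E) E) \<and>
    (porous D E \<longleftrightarrow>
      (\<exists>\<alpha>>0. \<exists>\<zeta>>0. \<forall>R\<in>D.
        (\<Sum>\<^sub>\<infinity>Q\<in>dyadic_meeting E R. ennreal (measure lebesgue Q powr (1 - \<alpha> / real CARD('n))))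
          \<le> ennreal (\<zeta> * measure lebesgue R powr (1 - \<alpha> / real CARD('n))))) \<and>
    (porous D E \<longleftrightarrow>
      emeasure lebesgue (closure E) = 0 \<and>
      (\<exists>\<alpha>>0. \<exists>\<xi>>0. \<forall>R\<in>D.
        dist_weight \<alpha> E R < \<infinity> \<and>
        (\<Sum>\<^sub>\<infinity>Q\<in>dyadic_meeting E R. dist_weight \<alpha> E Q) \<le> ennreal \<xi> * dist_weight \<alpha> E R))"
    (is "(_ \<longleftrightarrow> ?ii) \<and> (_ \<longleftrightarrow> ?iii) \<and> (_ \<longleftrightarrow> _ \<and> ?iv)")
proof -
  note E = assms(1) and D = assms(2)
  \<comment> \<open>All equivalences pass through porosity, which yields the power-sum and the
    weight condition with one and the same \<open>\<alpha>\<close>.\<close>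
  have "?ii \<and> ?iii \<and> emeasure lebesgue (closure E) = 0 \<and> ?iv" if por: "porous D E"
  proof -
    have up: "uniformly_porous E" by (rule porous_imp_uniformly_porous[OF D por])
    obtain C \<gamma> where bd: "meeting_bound E C \<gamma>" using uniformly_porous_imp_meeting_bound[OF up] .
    obtain \<alpha> where \<alpha>: "0 < \<alpha>" and r: "2 powr \<alpha> * \<gamma> < 1" using meeting_bound_exponent[OF bd] .
    have C: "0 < C" using bd by (simp add: meeting_bound_def)
    define K where "K = 1 + 2 powr \<alpha> * C * 9 ^ CARD('n) / (1 - 2 powr \<alpha> * \<gamma>)"
    have K: "0 < K" using C r unfolding K_def by (intro add_pos_nonneg divide_nonneg_pos) auto
    have W: "dist_weight \<alpha> E (hcube a l) \<le> ennreal (K * l powr (real CARD('n) - \<alpha>))" if "0 < l" for a l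
      unfolding K_def by (rule dist_weight_le[OF E bd \<alpha> r that])
    have "(\<Sum>\<^sub>\<infinity>Q\<in>dyadic_meeting E R. ennreal (measure lebesgue Q powr (1 - \<alpha> / real CARD('n))))
          \<le> ennreal (C / (1 - 2 powr \<alpha> * \<gamma>) * measure lebesgue R powr (1 - \<alpha> / real CARD('n)))"
      if R: "R \<in> D" for R
    proof -
      obtain a l where l: "0 < l" "R = hcube a l" using lattice_cube[OF D R] .
      show ?thesis
        using infsum_dyadic_meeting_le[OF bd r _ l(1), of 1
            "\<lambda>Q. ennreal (measure lebesgue Q powr (1 - \<alpha> / real CARD('n)))" a]
        by (simp add: measure_hcube_powr l)
    qed
    moreover have "0 < C / (1 - 2 powr \<alpha> * \<gamma>)" using C r by simp
    ultimately have iii: ?iii using \<alpha> by blast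
    have fin: "dist_weight \<alpha> E R < \<infinity>" if R: "R \<in> D" for R
    proof -
      obtain a l where l: "0 < l" "R = hcube a l" using lattice_cube[OF D R] .
      show ?thesis using le_less_trans[OF W[OF l(1), of a] ennreal_less_top] l(2) by simp
    qed
    have sum: "(\<Sum>\<^sub>\<infinity>Q\<in>dyadic_meeting E R. dist_weight \<alpha> E Q)
        \<le> ennreal (K * C / (1 - 2 powr \<alpha> * \<gamma>)) * dist_weight \<alpha> E R" if R: "R \<in> D" for R
    proof -
      obtain a l where l: "0 < l" "R = hcube a l" using lattice_cube[OF D R] .
      show ?thesis
      \<comment> \<open>The lower bound for the weight of \<open>R\<close> is available only if
        \<open>R\<close> meets \<open>E\<close>; otherwise the sum is empty.\<close>
      proof (cases "R \<inter> E = {}")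
        case True
        have "Q \<subseteq> R" if "Q \<in> dyadic R" for Q
          using that dyadic_gen_subset[OF l(1)] l(2) unfolding dyadic_def by blast
        then have "dyadic_meeting E R = {}" using True unfolding dyadic_meeting_def by blast
        then show ?thesis by simp
      next
        case False
        have "(\<Sum>\<^sub>\<infinity>Q\<in>dyadic_meeting E R. dist_weight \<alpha> E Q)
            \<le> ennreal (K * C / (1 - 2 powr \<alpha> * \<gamma>) * l powr (real CARD('n) - \<alpha>))"
          unfolding l(2) using K W by (intro infsum_dyadic_meeting_le[OF bd r _ l(1)]) auto
        also have "\<dots> = ennreal (K * C / (1 - 2 powr \<alpha> * \<gamma>)) * ennreal (l powr (real CARD('n) - \<alpha>))"
          using K C r by (intro ennreal_mult) auto
        also have "\<dots> \<le> ennreal (K * C / (1 - 2 powr \<alpha> * \<gamma>)) * dist_weight \<alpha> E R"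
          using dist_weight_ge[OF l(1), of \<alpha> a E] \<alpha> False l(2) by (intro mult_left_mono) auto
        finally show ?thesis .
      qed
    qed
    moreover have "0 < K * C / (1 - 2 powr \<alpha> * \<gamma>)" using K C r by simp
    ultimately have ?iv using \<alpha> fin by blast
    then show ?thesis
      using iii uniformly_porous_imp_well_sparse[OF D up] closure_null[OF D E fin] by blast
  qed
  moreover have "porous D E" if ?ii using well_sparse_imp_porous[OF D E that] .
  moreover have "porous D E" if ?iii using that sum_condition_imp_porous[OF D E] by blast
  moreover have "porous D E" if ?iv using that weight_condition_imp_porous[OF D E] by blast
  ultimately show ?thesis by blast
qed

end
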